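(* For each of the cases O, N, D, III, II, I let $\mathfrak s_\infty$ be the infinite-dimensional Lie algebra of contact vector fields on $J^1(\mathbb R^4)$ described in the context. Then there are no 1st order differential invariants for $\mathfrak s_\infty$. The only 2nd order differential invariant $I$ of the algebra $\mathfrak s_\infty$, up to the natural gauge $I\mapsto F(I)$, is the following: (O) $I_{\rm O}=u_{11}-u_{22}-u_{33}-u_{44}$ (in this case the functions $x^1,\dots,x^4$ are also invariant); (N) $I_{\rm N}=u_{24}-u_{13}+u_{11}u_{22}-u_{12}^2$; (D) $I_{\rm D}=u_{14}u_{23}-u_{13}u_{24}$; (III) $I_{\rm III}=(u_{24}-u_{14}u_{33}+u_{13}u_{34})/u_{34}$; (II) $I_{\rm II}=(u_{13}u_{24}-u_{12}u_{34})/u_{14}$; (I) $I_{\rm I}=(u_{12}u_{34}-u_{13}u_{24})/(u_{12}u_{34}-u_{14}u_{23})$.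
   Context: Coordinates on $\mathbb R^4$: $(x,y,z,t)=(x^1,x^2,x^3,x^4)$; $u_i,u_{ij}$ are the jet coordinates (partial derivatives of $u$), $u_x=u_1$, $u_y=u_2$, $u_z=u_3$, $u_t=u_4$. A contact vector field on $J^1(\mathbb R^4)$ is identified with its generating function $f\in C^\infty(J^1(\mathbb R^4))$. A differential invariant of order $k$ of a Lie algebra of contact fields is a (locally, generically defined) function $I$ on $J^k$ such that $L_{\hat X}I=0$ for all $X$ in the algebra, $\hat X$ being the prolongation of $X$. The algebras $\mathfrak s_\infty$ consist of all sums of the following generating functions, where the $A$'s are arbitrary smooth functions of the two indicated arguments: (O) all solutions $f=f(x^1,\dots,x^4)$ of $f_{11}-f_{22}-f_{33}-f_{44}=0$. (N) $A_i=A_i(t,z)$, $\nabla=x\partial_t+y\partial_z$: $\ \mathfrak a_0$: $A_{0t}u_z-A_{0z}u_t+(A_{0tt}x+A_{0tz}y)u_y-(A_{0tz}x+A_{0zz}y)u_x-\frac16\nabla^3A_0$; $\ \mathfrak a_1$: $A_{1t}u_y-A_{1z}u_x-\frac12\nabla^2A_1$; $\ \mathfrak a_2$: $\nabla A_2$; $\ \mathfrak a_3$: $A_3$ (in $\nabla^k$ the variables $x,y$ are treated as constants). (D) $A_i'=A_i'(x,y)$, $A_i''=A_i''(t,z)$: $\ \mathfrak a_0'$: $A'_{0x}u_y-A'_{0y}u_x$; $\ \mathfrak a_1'$: $A_1'$; $\ \mathfrak a_0''$: $A''_{0t}u_z-A''_{0z}u_t$; $\ \mathfrak a_1''$: $A_1''$.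 (III) $A_i'=A_i'(x,y)$, $A_0''=A_0''(t,u_t)$: $\ \mathfrak a_0'$: $A'_{0y}u_x-A'_{0x}u_y+\frac12(A'_{0yy}z^2-2A'_{0xy}zu_z+A'_{0xx}u_z^2)$; $\ \mathfrak a_1'$: $A'_{1y}z-A'_{1x}u_z$; $\ \mathfrak a_2'$: $A_2'$; $\ \mathfrak a_0''$: $A_0''$. (II) $A_i'=A_i'(y,z)$, $A_0''=A_0''(x,u_x)$, $A_0'''=A_0'''(t,u_t)$: $\ \mathfrak a_0'$: $A'_{0z}u_y-A'_{0y}u_z$; $\ \mathfrak a_1'$: $A_1'$; $\ \mathfrak a_0''$: $A_0''$; $\ \mathfrak a_0'''$: $A_0'''$. (I) $\mathfrak a_0'$: $A'(x,u_x)$; $\ \mathfrak a_0''$: $A''(y,u_y)$; $\ \mathfrak a_0'''$: $A'''(z,u_z)$; $\ \mathfrak a_0^{iv}$: $A^{iv}(t,u_t)$. *)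

theory Defs
  imports "HOL-Analysis.Analysis" "HOL-Library.Uprod"
begin

section \<open>Smooth functions\<close>

text \<open>Intended for open sets only.\<close>

primrec Ck_on :: "nat \<Rightarrow> 'a::euclidean_space set \<Rightarrow> ('a \<Rightarrow> real) \<Rightarrow> bool" where
  "Ck_on 0 U f \<longleftrightarrow> continuous_on U f"
| "Ck_on (Suc k) U f \<longleftrightarrow> (\<forall>x\<in>U. f differentiable (at x)) \<and>
     (\<forall>b\<in>Basis. Ck_on k U (\<lambda>x. frechet_derivative f (at x) b))"

definition smooth_on :: "'a::euclidean_space set \<Rightarrow> ('a \<Rightarrow> real) \<Rightarrow> bool" where
  "smooth_on U f \<longleftrightarrow> (\<forall>k. Ck_on k U f)"

definition pd :: "4 \<Rightarrow> (real^4 \<Rightarrow> real) \<Rightarrow> real^4 \<Rightarrow> real" where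
  "pd i f x = frechet_derivative f (at x) (axis i 1)"

definition D1 :: "(real \<times> real \<Rightarrow> real) \<Rightarrow> real \<times> real \<Rightarrow> real" where
  "D1 A s = frechet_derivative A (at s) (1, 0)"

definition D2 :: "(real \<times> real \<Rightarrow> real) \<Rightarrow> real \<times> real \<Rightarrow> real" where
  "D2 A s = frechet_derivative A (at s) (0, 1)"


section \<open>Jet spaces and contact vector fields\<close>

instance uprod :: (finite) finite
  by standard simp

text \<open>A point of \<open>J1\<close> is \<open>(x, u, p)\<close> with \<open>p $ i = u\<^sub>i\<close>; a point of \<open>J2\<close> is \<open>((x, u, p), H)\<close>
  with \<open>H $ Upair i j = u\<^sub>i\<^sub>j\<close>. Indexing by unordered pairs builds in \<open>u\<^sub>i\<^sub>j = u\<^sub>j\<^sub>i\<close>, so that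
  \<open>J2\<close> has dimension 4 + 1 + 4 + 10. The index type is \<open>4\<close>, in which the numeral 4 equals 0.\<close>

type_synonym J1 = "(real^4) \<times> real \<times> (real^4)"
type_synonym J2 = "J1 \<times> (real^(4 uprod))"

text \<open>\<open>X\<^sub>f = - f\<^bsub>u_i\<^esub> \<partial>\<^bsub>x_i\<^esub> + (f - u\<^sub>i f\<^bsub>u_i\<^esub>) \<partial>\<^bsub>u\<^esub> + (f\<^bsub>x_i\<^esub> + u\<^sub>i f\<^bsub>u\<^esub>) \<partial>\<^bsub>u_i\<^esub>\<close>: the contact field
  on which the contact form \<open>du - u\<^sub>i dx\<^sup>i\<close> takes the value \<open>f\<close>.\<close>

definition contact_field :: "(J1 \<Rightarrow> real) \<Rightarrow> J1 \<Rightarrow> J1" where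
  "contact_field f = (\<lambda>(x, u, p).
     let df = frechet_derivative f (at (x, u, p)) in
       (\<chi> i. - df (0, 0, axis i 1),
        f (x, u, p) - (\<Sum>i\<in>UNIV. p $ i * df (0, 0, axis i 1)),
        \<chi> i. df (axis i 1, p $ i, 0)))"

text \<open>\<open>\<D>\<^sub>i = \<partial>\<^bsub>x_i\<^esub> + u\<^sub>i \<partial>\<^bsub>u\<^esub> + u\<^sub>i\<^sub>l \<partial>\<^bsub>u_l\<^esub>\<close>.\<close>

definition total_derivative :: "4 \<Rightarrow> (J1 \<Rightarrow> real) \<Rightarrow> J2 \<Rightarrow> real" where
  "total_derivative i g = (\<lambda>((x, u, p), H).
     frechet_derivative g (at (x, u, p)) (axis i 1, p $ i, \<chi> l. H $ Upair i l))"

text \<open>The field with components \<open>\<xi>\<^sup>k\<close> along \<open>\<partial>\<^bsub>x_k\<^esub>\<close> and \<open>\<eta>\<^sub>i\<close> along \<open>\<partial>\<^bsub>u_i\<^esub>\<close> is prolonged by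
  \<open>\<eta>\<^sub>i\<^sub>j = \<D>\<^sub>j \<eta>\<^sub>i - u\<^sub>i\<^sub>k \<D>\<^sub>j \<xi>\<^sup>k\<close>. For contact fields \<open>\<eta>\<^sub>i\<^sub>j\<close> is symmetric, so the linear order of
  the index type, used to enumerate the coordinates \<open>u\<^sub>i\<^sub>j\<close> once each, is immaterial.\<close>

definition prolong :: "(J1 \<Rightarrow> J1) \<Rightarrow> J2 \<Rightarrow> J2" where
  "prolong X = (\<lambda>(q, H). (X q,
     \<Sum>i\<in>UNIV. \<Sum>j | i \<le> j.
       (total_derivative j (\<lambda>q. snd (snd (X q)) $ i) (q, H)
         - (\<Sum>k\<in>UNIV. H $ Upair i k * total_derivative j (\<lambda>q. fst (X q) $ k) (q, H)))
       *\<^sub>R axis (Upair i j) 1))"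


section \<open>Differential invariants\<close>

definition lie_derivative :: "('a \<Rightarrow> 'a) \<Rightarrow> ('a \<Rightarrow> real) \<Rightarrow> 'a::euclidean_space \<Rightarrow> real" where
  "lie_derivative X I w = frechet_derivative I (at w) (X w)"

definition invariant_on ::
  "('a \<Rightarrow> 'a) set \<Rightarrow> 'a::euclidean_space set \<Rightarrow> ('a \<Rightarrow> real) \<Rightarrow> bool" where
  "invariant_on XX U I \<longleftrightarrow>
     open U \<and> smooth_on U I \<and> (\<forall>X\<in>XX. \<forall>w\<in>U. lie_derivative X I w = 0)"

text \<open>In the following, \<open>S\<close> is a set of generating functions.\<close>

definition diff_invariant1 :: "(J1 \<Rightarrow> real) set \<Rightarrow> J1 set \<Rightarrow> (J1 \<Rightarrow> real) \<Rightarrow> bool" where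
  "diff_invariant1 S = invariant_on (contact_field ` S)"

definition diff_invariant2 :: "(J1 \<Rightarrow> real) set \<Rightarrow> J2 set \<Rightarrow> (J2 \<Rightarrow> real) \<Rightarrow> bool" where
  "diff_invariant2 S = invariant_on ((\<lambda>f. prolong (contact_field f)) ` S)"

definition locally_function_of ::
  "'a::euclidean_space set \<Rightarrow> ('a \<Rightarrow> real) \<Rightarrow> ('a \<Rightarrow> 'b::euclidean_space) \<Rightarrow> bool" where
  "locally_function_of U I G \<longleftrightarrow>
     (\<forall>w\<in>U. \<exists>V W F. open V \<and> w \<in> V \<and> V \<subseteq> U \<and> open W \<and> G ` V \<subseteq> W \<and>
        smooth_on W F \<and> (\<forall>v\<in>V. I v = F (G v)))"

text \<open>\<open>D\<close> is the domain of definition of \<open>G\<close>.\<close>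

definition generically_function_of ::
  "'a::euclidean_space set \<Rightarrow> ('a \<Rightarrow> real) \<Rightarrow> 'a set \<Rightarrow> ('a \<Rightarrow> 'b::euclidean_space) \<Rightarrow> bool" where
  "generically_function_of U I D G \<longleftrightarrow>
     (\<exists>U'. open U' \<and> U' \<subseteq> U \<inter> D \<and> U \<subseteq> closure U' \<and> locally_function_of U' I G)"

text \<open>Genericity need not be allowed for here: a smooth function that is locally constant on a
  dense open subset of an open set is locally constant on the whole of it.\<close>

definition no_diff_invariants1 :: "(J1 \<Rightarrow> real) set \<Rightarrow> bool" where
  "no_diff_invariants1 S \<longleftrightarrow>
     (\<forall>U I. diff_invariant1 S U I \<longrightarrow>
       (\<forall>q\<in>U. \<exists>V. open V \<and> q \<in> V \<and> V \<subseteq> U \<and> I constant_on V))"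

definition only_diff_invariant2 ::
  "(J1 \<Rightarrow> real) set \<Rightarrow> J2 set \<Rightarrow> (J2 \<Rightarrow> real) \<Rightarrow> bool" where
  "only_diff_invariant2 S D J \<longleftrightarrow>
     closure D = UNIV \<and> diff_invariant2 S D J \<and>
     (\<forall>U I. diff_invariant2 S U I \<longrightarrow> generically_function_of U I D J)"


section \<open>The algebras\<close>

definition alg_O :: "(J1 \<Rightarrow> real) set" where
  "alg_O = {(\<lambda>(x, u, p). f x) | f. smooth_on UNIV f \<and>
     (\<forall>x. pd 1 (pd 1 f) x - pd 2 (pd 2 f) x - pd 3 (pd 3 f) x - pd 4 (pd 4 f) x = 0)}"

text \<open>\<open>\<nabla> = x \<partial>\<^sub>t + y \<partial>\<^sub>z\<close> acting on functions of \<open>(t, z)\<close>.\<close>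

definition nabla :: "real \<Rightarrow> real \<Rightarrow> (real \<times> real \<Rightarrow> real) \<Rightarrow> real \<times> real \<Rightarrow> real" where
  "nabla x y A = (\<lambda>s. x * D1 A s + y * D2 A s)"

definition N0 :: "(real \<times> real \<Rightarrow> real) \<Rightarrow> J1 \<Rightarrow> real" where
  "N0 A = (\<lambda>(X, u, p). let x = X $ 1; y = X $ 2; z = X $ 3; t = X $ 4 in
     D1 A (t, z) * p $ 3 - D2 A (t, z) * p $ 4
     + (D1 (D1 A) (t, z) * x + D2 (D1 A) (t, z) * y) * p $ 2
     - (D2 (D1 A) (t, z) * x + D2 (D2 A) (t, z) * y) * p $ 1
     - 1/6 * (nabla x y ^^ 3) A (t, z))"

definition N1 :: "(real \<times> real \<Rightarrow> real) \<Rightarrow> J1 \<Rightarrow> real" where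
  "N1 A = (\<lambda>(X, u, p). let x = X $ 1; y = X $ 2; z = X $ 3; t = X $ 4 in
     D1 A (t, z) * p $ 2 - D2 A (t, z) * p $ 1 - 1/2 * (nabla x y ^^ 2) A (t, z))"

definition N2 :: "(real \<times> real \<Rightarrow> real) \<Rightarrow> J1 \<Rightarrow> real" where
  "N2 A = (\<lambda>(X, u, p). let x = X $ 1; y = X $ 2; z = X $ 3; t = X $ 4 in nabla x y A (t, z))"

definition N3 :: "(real \<times> real \<Rightarrow> real) \<Rightarrow> J1 \<Rightarrow> real" where
  "N3 A = (\<lambda>(X, u, p). let z = X $ 3; t = X $ 4 in A (t, z))"

definition alg_N :: "(J1 \<Rightarrow> real) set" where
  "alg_N = {(\<lambda>q. N0 A\<^sub>0 q + N1 A\<^sub>1 q + N2 A\<^sub>2 q + N3 A\<^sub>3 q) | A\<^sub>0 A\<^sub>1 A\<^sub>2 A\<^sub>3.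
     smooth_on UNIV A\<^sub>0 \<and> smooth_on UNIV A\<^sub>1 \<and> smooth_on UNIV A\<^sub>2 \<and> smooth_on UNIV A\<^sub>3}"

definition alg_D :: "(J1 \<Rightarrow> real) set" where
  "alg_D = {(\<lambda>(X, u, p). let x = X $ 1; y = X $ 2; z = X $ 3; t = X $ 4 in
       (D1 A\<^sub>0 (x, y) * p $ 2 - D2 A\<^sub>0 (x, y) * p $ 1) + A\<^sub>1 (x, y)
     + (D1 B\<^sub>0 (t, z) * p $ 3 - D2 B\<^sub>0 (t, z) * p $ 4) + B\<^sub>1 (t, z)) | A\<^sub>0 A\<^sub>1 B\<^sub>0 B\<^sub>1.
     smooth_on UNIV A\<^sub>0 \<and> smooth_on UNIV A\<^sub>1 \<and> smooth_on UNIV B\<^sub>0 \<and> smooth_on UNIV B\<^sub>1}"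

definition alg_III :: "(J1 \<Rightarrow> real) set" where
  "alg_III = {(\<lambda>(X, u, p). let x = X $ 1; y = X $ 2; z = X $ 3; t = X $ 4 in
       (D2 A\<^sub>0 (x, y) * p $ 1 - D1 A\<^sub>0 (x, y) * p $ 2
        + 1/2 * (D2 (D2 A\<^sub>0) (x, y) * z^2 - 2 * D2 (D1 A\<^sub>0) (x, y) * z * p $ 3
                 + D1 (D1 A\<^sub>0) (x, y) * (p $ 3)^2))
     + (D2 A\<^sub>1 (x, y) * z - D1 A\<^sub>1 (x, y) * p $ 3) + A\<^sub>2 (x, y)
     + B\<^sub>0 (t, p $ 4)) | A\<^sub>0 A\<^sub>1 A\<^sub>2 B\<^sub>0.
     smooth_on UNIV A\<^sub>0 \<and> smooth_on UNIV A\<^sub>1 \<and> smooth_on UNIV A\<^sub>2 \<and> smooth_on UNIV B\<^sub>0}"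

definition alg_II :: "(J1 \<Rightarrow> real) set" where
  "alg_II = {(\<lambda>(X, u, p). let x = X $ 1; y = X $ 2; z = X $ 3; t = X $ 4 in
       (D2 A\<^sub>0 (y, z) * p $ 2 - D1 A\<^sub>0 (y, z) * p $ 3) + A\<^sub>1 (y, z)
     + B\<^sub>0 (x, p $ 1) + C\<^sub>0 (t, p $ 4)) | A\<^sub>0 A\<^sub>1 B\<^sub>0 C\<^sub>0.
     smooth_on UNIV A\<^sub>0 \<and> smooth_on UNIV A\<^sub>1 \<and> smooth_on UNIV B\<^sub>0 \<and> smooth_on UNIV C\<^sub>0}"

definition alg_I :: "(J1 \<Rightarrow> real) set" where
  "alg_I = {(\<lambda>(X, u, p). A\<^sub>1 (X $ 1, p $ 1) + A\<^sub>2 (X $ 2, p $ 2)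
                          + A\<^sub>3 (X $ 3, p $ 3) + A\<^sub>4 (X $ 4, p $ 4)) | A\<^sub>1 A\<^sub>2 A\<^sub>3 A\<^sub>4.
     smooth_on UNIV A\<^sub>1 \<and> smooth_on UNIV A\<^sub>2 \<and> smooth_on UNIV A\<^sub>3 \<and> smooth_on UNIV A\<^sub>4}"


section \<open>The second order invariants\<close>

definition uu :: "4 \<Rightarrow> 4 \<Rightarrow> J2 \<Rightarrow> real" where
  "uu i j w = snd w $ Upair i j"

definition I_O :: "J2 \<Rightarrow> real" where
  "I_O w = uu 1 1 w - uu 2 2 w - uu 3 3 w - uu 4 4 w"

definition I_N :: "J2 \<Rightarrow> real" where
  "I_N w = uu 2 4 w - uu 1 3 w + uu 1 1 w * uu 2 2 w - (uu 1 2 w)^2"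

definition I_D :: "J2 \<Rightarrow> real" where
  "I_D w = uu 1 4 w * uu 2 3 w - uu 1 3 w * uu 2 4 w"

definition I_III :: "J2 \<Rightarrow> real" where
  "I_III w = (uu 2 4 w - uu 1 4 w * uu 3 3 w + uu 1 3 w * uu 3 4 w) / uu 3 4 w"

definition I_II :: "J2 \<Rightarrow> real" where
  "I_II w = (uu 1 3 w * uu 2 4 w - uu 1 2 w * uu 3 4 w) / uu 1 4 w"

definition I_I :: "J2 \<Rightarrow> real" where
  "I_I w = (uu 1 2 w * uu 3 4 w - uu 1 3 w * uu 2 4 w)
           / (uu 1 2 w * uu 3 4 w - uu 1 4 w * uu 2 3 w)"

end

theory Submission
  imports Defs
begin

text \<open>A generating function \<open>f\<close> that does not depend on \<open>u\<close> is prolonged by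
  \<open>\<eta>\<^sub>i\<^sub>j = f''(T\<^sub>i, T\<^sub>j)\<close>, where \<open>f''\<close> is its second derivative and \<open>T\<^sub>i = (e\<^sub>i, u\<^sub>i, (u\<^sub>i\<^sub>l)\<^sub>l)\<close>.
  Apart from case O, every algebra contains the Heisenberg algebra spanned by \<open>1, x\<^sub>i, u\<^sub>i\<close>; it is
  transitive on \<open>J\<^sup>1\<close> with vanishing second order part, so there are no first order invariants and
  the differential of a second order invariant only involves the \<open>du\<^sub>i\<^sub>j\<close>. Invariance of the given
  function is then an identity in the Hessians. For uniqueness, the quadratic generating functions in
  the algebra give linear equations for the coefficients of that differential, whose solution space
  is generically spanned by the differential of the given function \<open>J\<close>. Since \<open>J\<close> is affine in one
  of the \<open>u\<^sub>i\<^sub>j\<close>, that coordinate can be replaced by \<open>J\<close>, and any other invariant is constant in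
  the remaining coordinates.\<close>

subsection \<open>Calculus of smooth functions\<close>

text \<open>Pointwise, the uniqueness question is linear algebra: the differential of an invariant
  has ten coefficients along the u_ij, and it must annihilate the Hessian part of every prolonged
  field. The differential of \<open>J\<close> is itself a solution, so at most nine independent
  equations can exist; nine to twelve quadratic generating functions supply them. Solving these
  equations and normalising the pivot coordinate require division by certain u_ij, which together
  with the denominators of the invariants accounts for all the dense open sets. Passing from "dI is
  a multiple of dJ" to "I is a function of J" would in general call for the implicit function
  theorem; affineness in one coordinate makes the projection onto a level set of \<open>J\<close>
  explicit, and only affine substitutions of smooth functions remain. Case O differs: the functions
  u_i are not among its generating functions, so dI may keep components along the dx_i. There the
  complete invariants x and \<open>I_O\<close> are linear, their fibres are affine subspaces, and an
  invariant is constant along segments inside a fibre.\<close>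

lemma Ck_on_cong:
  assumes "open U" "\<And>x. x \<in> U \<Longrightarrow> f x = g x" "Ck_on k U f"
  shows "Ck_on k U g"
  using assms(2,3)
proof (induction k arbitrary: f g)
  case 0
  then show ?case using continuous_on_cong by (metis Ck_on.simps(1))
next
  case (Suc k)
  have g: "(g has_derivative frechet_derivative f (at x)) (at x)" if "x \<in> U" for x
  proof -
    have "(f has_derivative frechet_derivative f (at x)) (at x)"
      using Suc.prems(2) that frechet_derivative_works by auto
    then show ?thesis
      using has_derivative_transform_within_open[OF _ assms(1) that] Suc.prems(1) by blast
  qed
  have eq: "frechet_derivative f (at x) = frechet_derivative g (at x)" if "x \<in> U" for x
    by (rule frechet_derivative_at[OF g[OF that]])
  have "Ck_on k U (\<lambda>x. frechet_derivative g (at x) b)" if "b \<in> Basis" for b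
    by (rule Suc.IH[of "\<lambda>x. frechet_derivative f (at x) b"]) (use Suc.prems(2) that eq in auto)
  moreover have "g differentiable (at x)" if "x \<in> U" for x
    using g[OF that] differentiable_def by blast
  ultimately show ?case by simp
qed

text \<open>\<open>Ck_on\<close> is phrased through \<open>frechet_derivative\<close>; openness of
  \<open>U\<close> allows any explicit derivative \<open>f'\<close> to replace it, and this is how
  each differentiation rule enters an induction on \<open>k\<close>.\<close>

lemma Ck_on_Suc_derivI:
  assumes "\<And>x. x \<in> U \<Longrightarrow> (f has_derivative f' x) (at x)"
    and "open U" and "\<And>b. b \<in> Basis \<Longrightarrow> Ck_on k U (\<lambda>x. f' x b)"
  shows "Ck_on (Suc k) U f"
proof -
  have "f' x = frechet_derivative f (at x)" if "x \<in> U" for x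
    by (rule frechet_derivative_at[OF assms(1)[OF that]])
  then have "Ck_on k U (\<lambda>x. frechet_derivative f (at x) b)" if "b \<in> Basis" for b
    using Ck_on_cong[OF assms(2) _ assms(3)[OF that]] by simp
  moreover have "f differentiable (at x)" if "x \<in> U" for x
    using assms(1)[OF that] differentiable_def by blast
  ultimately show ?thesis by simp
qed

lemma Ck_on_differentiable_imp_continuous_on:
  "Ck_on (Suc k) U f \<Longrightarrow> continuous_on U f"
  by (auto intro!: continuous_at_imp_continuous_on differentiable_imp_continuous_within)

lemma Ck_on_lower: "Ck_on (Suc k) U f \<Longrightarrow> Ck_on k U f"
proof (induction k arbitrary: f)
  case 0
  then show ?case using Ck_on_differentiable_imp_continuous_on[of 0 U f] by simp
next
  case (Suc k)
  then show ?case by simp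
qed

lemma Ck_on_has_derivative:
  "Ck_on (Suc k) U f \<Longrightarrow> x \<in> U \<Longrightarrow> (f has_derivative frechet_derivative f (at x)) (at x)"
  using frechet_derivative_works by auto

lemma Ck_on_const: "open U \<Longrightarrow> Ck_on k U (\<lambda>x. c)"
  by (induction k arbitrary: c) (auto intro!: continuous_intros)

lemma Ck_on_bounded_linear:
  assumes "open U" "bounded_linear l" shows "Ck_on k U l"
proof (cases k)
  case 0
  then show ?thesis using assms by (simp add: linear_continuous_on)
next
  case (Suc n)
  show ?thesis unfolding Suc
    by (rule Ck_on_Suc_derivI[where f'="\<lambda>x. l"])
      (use assms in \<open>auto intro!: bounded_linear_imp_has_derivative Ck_on_const\<close>)
qed

lemma Ck_on_add:
  "open U \<Longrightarrow> Ck_on k U f \<Longrightarrow> Ck_on k U g \<Longrightarrow> Ck_on k U (\<lambda>x. f x + g x)"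
proof (induction k arbitrary: f g)
  case 0
  then show ?case by (auto intro: continuous_intros)
next
  case (Suc k)
  show ?case
    by (rule Ck_on_Suc_derivI[where
          f'="\<lambda>x v. frechet_derivative f (at x) v + frechet_derivative g (at x) v"])
      (use Suc in \<open>auto intro!: has_derivative_add simp flip: frechet_derivative_works\<close>)
qed

lemma Ck_on_mult:
  "open U \<Longrightarrow> Ck_on k U f \<Longrightarrow> Ck_on k U g \<Longrightarrow> Ck_on k U (\<lambda>x. f x * g x)"
proof (induction k arbitrary: f g)
  case 0
  then show ?case by (auto intro: continuous_intros)
next
  case (Suc k)
  show ?case
  proof (rule Ck_on_Suc_derivI)
    show "((\<lambda>x. f x * g x) has_derivative
        (\<lambda>v. f x * frechet_derivative g (at x) v + frechet_derivative f (at x) v * g x)) (at x)"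
      if "x \<in> U" for x
      using Suc.prems that by (intro has_derivative_mult Ck_on_has_derivative)
    show "Ck_on k U (\<lambda>x. f x * frechet_derivative g (at x) b + frechet_derivative f (at x) b * g x)"
      if "b \<in> Basis" for b
      using Suc.prems that Ck_on_lower[OF Suc.prems(2)] Ck_on_lower[OF Suc.prems(3)]
      by (intro Ck_on_add Suc.IH) auto
  qed (use Suc.prems in auto)
qed

lemma Ck_on_sum:
  assumes "open U" "finite A" "\<And>i. i \<in> A \<Longrightarrow> Ck_on k U (f i)"
  shows "Ck_on k U (\<lambda>x. \<Sum>i\<in>A. f i x)"
  using assms(2,3) by induction (auto intro: Ck_on_const Ck_on_add assms(1))

text \<open>The derivative of 1/f is a product of two factors 1/f and a derivative of
  \<open>f\<close>. So the induction keeps \<open>f\<close> fixed and uses its hypothesis for 1/f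
  itself.\<close>

lemma Ck_on_inverse:
  "open U \<Longrightarrow> Ck_on k U f \<Longrightarrow> (\<And>x. x \<in> U \<Longrightarrow> f x \<noteq> 0) \<Longrightarrow> Ck_on k U (\<lambda>x. inverse (f x))"
proof (induction k)
  case 0
  then show ?case by (auto intro: continuous_intros)
next
  case (Suc k)
  have inv: "Ck_on k U (\<lambda>x. inverse (f x))"
    using Suc Ck_on_lower[OF Suc.prems(2)] by auto
  show ?case
  proof (rule Ck_on_Suc_derivI)
    show "((\<lambda>x. inverse (f x)) has_derivative
        (\<lambda>v. - (inverse (f x) * frechet_derivative f (at x) v * inverse (f x)))) (at x)"
      if "x \<in> U" for x
      using Suc.prems that by (intro Deriv.has_derivative_inverse Ck_on_has_derivative)
    have "Ck_on k U (\<lambda>x. (-1) * (inverse (f x) * frechet_derivative f (at x) b * inverse (f x)))"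
      if "b \<in> Basis" for b
      using Suc.prems that inv by (intro Ck_on_mult Ck_on_const) auto
    then show "Ck_on k U (\<lambda>x. - (inverse (f x) * frechet_derivative f (at x) b * inverse (f x)))"
      if "b \<in> Basis" for b
      using that by simp
  qed (use Suc.prems in auto)
qed

text \<open>The coefficients \<open>l v \<bullet> b\<close> of the chain rule do not depend on the
  point. Partial derivatives of the composite are therefore constant combinations of composites of
  the same kind, and the induction closes.\<close>

lemma Ck_on_affine_comp:
  fixes l :: "'b::euclidean_space \<Rightarrow> 'a::euclidean_space"
  assumes "open U" "open W" "bounded_linear l" "\<And>y. y \<in> W \<Longrightarrow> a + l y \<in> U"
  shows "Ck_on k U f \<Longrightarrow> Ck_on k W (\<lambda>y. f (a + l y))"
proof (induction k arbitrary: f)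
  case 0
  then show ?case
    using assms linear_continuous_on[OF assms(3)]
    by (auto intro!: continuous_on_compose2[of U f] continuous_intros)
next
  case (Suc k)
  show ?case
  proof (rule Ck_on_Suc_derivI[where
        f'="\<lambda>y v. \<Sum>b\<in>Basis. (l v \<bullet> b) * frechet_derivative f (at (a + l y)) b"])
    fix y assume "y \<in> W"
    then have *: "(f has_derivative frechet_derivative f (at (a + l y))) (at (a + l y))"
      using assms Ck_on_has_derivative[OF Suc.prems] by auto
    then have lin: "linear (frechet_derivative f (at (a + l y)))"
      using has_derivative_linear by blast
    have eq: "frechet_derivative f (at (a + l y)) (l v) =
        (\<Sum>b\<in>Basis. (l v \<bullet> b) * frechet_derivative f (at (a + l y)) b)" for v
      by (subst (1) euclidean_representation[of "l v", symmetric])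
        (simp add: linear_sum[OF lin] linear_cmul[OF lin] del: euclidean_representation)
    have "((\<lambda>y. f (a + l y)) has_derivative (\<lambda>v. frechet_derivative f (at (a + l y)) (l v))) (at y)"
      by (rule has_derivative_compose[where f="\<lambda>y. a + l y" and f'=l, OF _ *])
        (auto intro!: derivative_eq_intros bounded_linear_imp_has_derivative assms(3))
    then show "((\<lambda>y. f (a + l y)) has_derivative
        (\<lambda>v. \<Sum>b\<in>Basis. (l v \<bullet> b) * frechet_derivative f (at (a + l y)) b)) (at y)"
      by (simp add: eq)
  next
    show "Ck_on k W (\<lambda>y. \<Sum>b\<in>Basis. (l v \<bullet> b) * frechet_derivative f (at (a + l y)) b)" for v
      using Suc by (intro Ck_on_sum Ck_on_mult Ck_on_const assms) auto
  qed (use assms in auto)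
qed

lemma smooth_on_const: "open U \<Longrightarrow> smooth_on U (\<lambda>x. c)"
  and smooth_on_bounded_linear: "open U \<Longrightarrow> bounded_linear l \<Longrightarrow> smooth_on U l"
  and smooth_on_add: "open U \<Longrightarrow> smooth_on U f \<Longrightarrow> smooth_on U g \<Longrightarrow> smooth_on U (\<lambda>x. f x + g x)"
  and smooth_on_mult: "open U \<Longrightarrow> smooth_on U f \<Longrightarrow> smooth_on U g \<Longrightarrow> smooth_on U (\<lambda>x. f x * g x)"
  by (auto simp: smooth_on_def Ck_on_const Ck_on_bounded_linear Ck_on_add Ck_on_mult)

lemma smooth_on_uminus: "open U \<Longrightarrow> smooth_on U f \<Longrightarrow> smooth_on U (\<lambda>x. - f x)"
  using smooth_on_mult[OF _ smooth_on_const, of U f "-1"] by simp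

lemma smooth_on_diff:
  "open U \<Longrightarrow> smooth_on U f \<Longrightarrow> smooth_on U g \<Longrightarrow> smooth_on U (\<lambda>x. f x - g x)"
  using smooth_on_add[OF _ _ smooth_on_uminus, of U f g] by simp

lemma smooth_on_power: "open U \<Longrightarrow> smooth_on U f \<Longrightarrow> smooth_on U (\<lambda>x. f x ^ n)"
  by (induction n) (auto intro: smooth_on_const smooth_on_mult)

lemma smooth_on_divide:
  "open U \<Longrightarrow> smooth_on U f \<Longrightarrow> smooth_on U g \<Longrightarrow> (\<And>x. x \<in> U \<Longrightarrow> g x \<noteq> 0) \<Longrightarrow>
    smooth_on U (\<lambda>x. f x / g x)"
  by (auto simp: smooth_on_def divide_inverse intro!: Ck_on_mult Ck_on_inverse)

lemma smooth_on_affine_comp: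
  fixes l :: "'b::euclidean_space \<Rightarrow> 'a::euclidean_space"
  assumes "smooth_on U f" "open U" "open W" "bounded_linear l" "\<And>y. y \<in> W \<Longrightarrow> a + l y \<in> U"
  shows "smooth_on W (\<lambda>y. f (a + l y))"
  using assms Ck_on_affine_comp[OF assms(2-5)] by (auto simp: smooth_on_def)

lemma smooth_on_has_derivative:
  "smooth_on U f \<Longrightarrow> x \<in> U \<Longrightarrow> (f has_derivative frechet_derivative f (at x)) (at x)"
  unfolding smooth_on_def by (meson Ck_on_has_derivative)

lemma smooth_on_continuous_on: "smooth_on U f \<Longrightarrow> continuous_on U f"
  unfolding smooth_on_def by (metis Ck_on.simps(1))

lemma smooth_on_frechet_derivative:
  "smooth_on U f \<Longrightarrow> b \<in> Basis \<Longrightarrow> smooth_on U (\<lambda>x. frechet_derivative f (at x) b)"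
  unfolding smooth_on_def by (metis Ck_on.simps(2))

subsection \<open>Second derivatives\<close>

text \<open>A relation with explicit \<open>f'\<close> and \<open>f''\<close>: applied backwards,
  its closure rules construct both derivatives by unification. Symmetry of \<open>f''\<close> is a
  clause of its own, so that sums, products and linear substitutions transport it and smoothness has
  to provide it only for the parameter functions.\<close>

definition jet2 :: "('a::real_normed_vector \<Rightarrow> real) \<Rightarrow> ('a \<Rightarrow> 'a \<Rightarrow> real) \<Rightarrow>
    ('a \<Rightarrow> 'a \<Rightarrow> 'a \<Rightarrow> real) \<Rightarrow> bool" where
  "jet2 f f' f'' \<longleftrightarrow> (\<forall>q. (f has_derivative f' q) (at q)) \<and>
     (\<forall>q v. ((\<lambda>q. f' q v) has_derivative f'' q v) (at q)) \<and>
     (\<forall>q v w. f'' q v w = f'' q w v)"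

lemma jet2_const: "jet2 (\<lambda>q. c) (\<lambda>q v. 0) (\<lambda>q v w. 0)"
  by (auto simp: jet2_def)

lemma jet2_bounded_linear: "bounded_linear l \<Longrightarrow> jet2 l (\<lambda>q v. l v) (\<lambda>q v w. 0)"
  by (auto simp: jet2_def intro: bounded_linear_imp_has_derivative)

lemma jet2_add: "jet2 f f' f'' \<Longrightarrow> jet2 g g' g'' \<Longrightarrow>
    jet2 (\<lambda>q. f q + g q) (\<lambda>q v. f' q v + g' q v) (\<lambda>q v w. f'' q v w + g'' q v w)"
  by (auto simp: jet2_def intro!: has_derivative_add)

lemma jet2_mult: "jet2 f f' f'' \<Longrightarrow> jet2 g g' g'' \<Longrightarrow>
    jet2 (\<lambda>q. f q * g q) (\<lambda>q v. f q * g' q v + f' q v * g q)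
      (\<lambda>q v w. f q * g'' q v w + f' q w * g' q v + f' q v * g' q w + f'' q v w * g q)"
  unfolding jet2_def
  by (auto intro!: derivative_eq_intros simp: algebra_simps)

lemma jet2_comp_linear:
  assumes "jet2 A A' A''" "bounded_linear l"
  shows "jet2 (\<lambda>q. A (l q)) (\<lambda>q v. A' (l q) (l v)) (\<lambda>q v w. A'' (l q) (l v) (l w))"
  using assms unfolding jet2_def
  by (auto intro!: has_derivative_compose[where f=l and f'=l] bounded_linear_imp_has_derivative)

text \<open>The mean value theorem is used twice: for s \<mapsto> f(q + h w + s v) - f(q + s v),
  then for the derivative in direction \<open>v\<close> along the line of direction
  \<open>w\<close>.\<close>

lemma second_difference_mvt:
  fixes f :: "'a::real_normed_vector \<Rightarrow> real"
  assumes f: "\<And>q. (f has_derivative f' q) (at q)"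
    and f': "\<And>q. ((\<lambda>q. f' q v) has_derivative f'' q) (at q)"
    and h: "0 < h"
  shows "\<exists>s t. 0 < s \<and> s < h \<and> 0 < t \<and> t < h \<and>
    f (q + h *\<^sub>R v + h *\<^sub>R w) - f (q + h *\<^sub>R v) - f (q + h *\<^sub>R w) + f q
      = h * h * f'' (q + s *\<^sub>R v + t *\<^sub>R w) w"
proof -
  have lin: "linear (f' q)" "linear (f'' q)" for q
    using f f' has_derivative_linear by blast+
  have dg: "((\<lambda>s. f (a + s *\<^sub>R v)) has_real_derivative f' (a + s *\<^sub>R v) v) (at s)" for a s
    unfolding has_field_derivative_def
    by (rule has_derivative_eq_rhs[OF has_derivative_compose[OF _ f]])
      (auto intro!: derivative_eq_intros simp: linear_cmul[OF lin(1)])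
  have dk: "((\<lambda>t. f' (a + t *\<^sub>R w) v) has_real_derivative f'' (a + t *\<^sub>R w) w) (at t)" for a t
    unfolding has_field_derivative_def
    by (rule has_derivative_eq_rhs[OF has_derivative_compose[OF _ f']])
      (auto intro!: derivative_eq_intros simp: linear_cmul[OF lin(2)])
  have "\<exists>s>0. s < h \<and>
    (f (q + h *\<^sub>R w + h *\<^sub>R v) - f (q + h *\<^sub>R v)) - (f (q + h *\<^sub>R w + 0 *\<^sub>R v) - f (q + 0 *\<^sub>R v))
      = (h - 0) * (f' (q + h *\<^sub>R w + s *\<^sub>R v) v - f' (q + s *\<^sub>R v) v)"
    by (rule MVT2[OF h]) (rule DERIV_diff[OF dg dg])
  then obtain s where s: "0 < s" "s < h" and
    "(f (q + h *\<^sub>R w + h *\<^sub>R v) - f (q + h *\<^sub>R v)) - (f (q + h *\<^sub>R w + 0 *\<^sub>R v) - f (q + 0 *\<^sub>R v))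
      = (h - 0) * (f' (q + h *\<^sub>R w + s *\<^sub>R v) v - f' (q + s *\<^sub>R v) v)"
    by blast
  moreover have "\<exists>t>0. t < h \<and>
    f' (q + s *\<^sub>R v + h *\<^sub>R w) v - f' (q + s *\<^sub>R v + 0 *\<^sub>R w) v
      = (h - 0) * f'' (q + s *\<^sub>R v + t *\<^sub>R w) w"
    by (rule MVT2[OF h]) (rule dk)
  then obtain t where t: "0 < t" "t < h" and
    "f' (q + s *\<^sub>R v + h *\<^sub>R w) v - f' (q + s *\<^sub>R v + 0 *\<^sub>R w) v
      = (h - 0) * f'' (q + s *\<^sub>R v + t *\<^sub>R w) w"
    by blast
  ultimately show ?thesis using s
    by (intro exI[of _ s] exI[of _ t]) (simp add: algebra_simps)
qed

text \<open>The second difference of \<open>f\<close> over the parallelogram spanned by h v and h w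
  is symmetric in \<open>v\<close> and \<open>w\<close>. It equals h^2 times either mixed derivative
  at some point of the parallelogram, and for small h continuity forces the two values at
  \<open>q\<close> to agree.\<close>

lemma second_derivative_symmetric:
  fixes f :: "'a::real_normed_vector \<Rightarrow> real"
  assumes f: "\<And>q. (f has_derivative f' q) (at q)"
    and v: "\<And>q. ((\<lambda>q. f' q v) has_derivative V q) (at q)"
    and w: "\<And>q. ((\<lambda>q. f' q w) has_derivative W q) (at q)"
    and cont: "isCont (\<lambda>q. V q w) q" "isCont (\<lambda>q. W q v) q"
  shows "V q w = W q v"
proof (rule ccontr)
  assume "V q w \<noteq> W q v"
  define e where "e = \<bar>V q w - W q v\<bar> / 2"
  then have e: "0 < e" using \<open>V q w \<noteq> W q v\<close> by simp
  obtain d1 where d1: "0 < d1" "\<And>x. dist x q < d1 \<Longrightarrow> \<bar>V x w - V q w\<bar> < e"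
    using cont(1) e unfolding continuous_at_eps_delta dist_real_def by meson
  obtain d2 where d2: "0 < d2" "\<And>x. dist x q < d2 \<Longrightarrow> \<bar>W x v - W q v\<bar> < e"
    using cont(2) e unfolding continuous_at_eps_delta dist_real_def by meson
  \<comment> \<open>The summand 1 keeps \<open>N\<close> positive even for v = w = 0 and makes the
    estimate against h N strict.\<close>
  define N where "N = norm v + norm w + 1"
  define h where "h = min d1 d2 / N"
  have N: "0 < N" unfolding N_def by (smt (verit) norm_ge_zero)
  have h: "0 < h" using d1 d2 N by (simp add: h_def)
  have close: "dist (q + s *\<^sub>R a + t *\<^sub>R b) q < min d1 d2"
    if "0 < s" "s < h" "0 < t" "t < h" "norm a + norm b + 1 = N" for s t a b
  proof -
    have "norm (s *\<^sub>R a + t *\<^sub>R b) \<le> s * norm a + t * norm b"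
      using norm_triangle_ineq[of "s *\<^sub>R a" "t *\<^sub>R b"] that by simp
    also have "\<dots> \<le> h * norm a + h * norm b"
      using that by (intro add_mono mult_right_mono) auto
    also have "\<dots> < h * N" using h that(5)[symmetric] by (simp add: algebra_simps)
    also have "\<dots> = min d1 d2" using N by (simp add: h_def)
    finally show ?thesis by (simp add: dist_norm add.assoc)
  qed
  obtain s t where st: "0 < s" "s < h" "0 < t" "t < h" and
    1: "f (q + h *\<^sub>R v + h *\<^sub>R w) - f (q + h *\<^sub>R v) - f (q + h *\<^sub>R w) + f q
      = h * h * V (q + s *\<^sub>R v + t *\<^sub>R w) w"
    using second_difference_mvt[OF f v h] by blast
  obtain s' t' where st': "0 < s'" "s' < h" "0 < t'" "t' < h" and
    2: "f (q + h *\<^sub>R w + h *\<^sub>R v) - f (q + h *\<^sub>R w) - f (q + h *\<^sub>R v) + f q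
      = h * h * W (q + s' *\<^sub>R w + t' *\<^sub>R v) v"
    using second_difference_mvt[OF f w h] by blast
  have "h * h * V (q + s *\<^sub>R v + t *\<^sub>R w) w = h * h * W (q + s' *\<^sub>R w + t' *\<^sub>R v) v"
    using 1 2 by (simp add: algebra_simps)
  then have "V (q + s *\<^sub>R v + t *\<^sub>R w) w = W (q + s' *\<^sub>R w + t' *\<^sub>R v) v"
    using h by simp
  moreover have "\<bar>V (q + s *\<^sub>R v + t *\<^sub>R w) w - V q w\<bar> < e"
    using close[OF st] d1 by (auto simp: N_def)
  moreover have "\<bar>W (q + s' *\<^sub>R w + t' *\<^sub>R v) v - W q v\<bar> < e"
    using close[OF st'] d2 by (auto simp: N_def)
  ultimately have "\<bar>V q w - W q v\<bar> < e + e" by linarith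
  then show False by (simp add: e_def)
qed

lemma smooth_on_mixed_derivative_commute:
  assumes "smooth_on UNIV f" "b \<in> Basis" "c \<in> Basis"
  shows "frechet_derivative (\<lambda>x. frechet_derivative f (at x) b) (at q) c =
    frechet_derivative (\<lambda>x. frechet_derivative f (at x) c) (at q) b"
proof -
  define f1 where "f1 v x = frechet_derivative f (at x) v" for v x
  have sm: "smooth_on UNIV (f1 v)" if "v \<in> Basis" for v
    unfolding f1_def by (rule smooth_on_frechet_derivative[OF assms(1) that])
  have der: "(f1 v has_derivative frechet_derivative (f1 v) (at q)) (at q)" if "v \<in> Basis" for v q
    using smooth_on_has_derivative[OF sm[OF that]] by simp
  have cont: "isCont (\<lambda>q. frechet_derivative (f1 v) (at q) w) q" if "v \<in> Basis" "w \<in> Basis" for v w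
    using smooth_on_continuous_on[OF smooth_on_frechet_derivative[OF sm[OF that(1)] that(2)]]
    by (simp add: continuous_on_eq_continuous_at)
  have f: "(f has_derivative (\<lambda>v. f1 v q)) (at q)" for q
    unfolding f1_def using smooth_on_has_derivative[OF assms(1)] by simp
  have "frechet_derivative (f1 b) (at q) c = frechet_derivative (f1 c) (at q) b"
    by (rule second_derivative_symmetric[where f=f and f'="\<lambda>q v. f1 v q"
          and V="\<lambda>q. frechet_derivative (f1 b) (at q)" and W="\<lambda>q. frechet_derivative (f1 c) (at q)"])
      (rule f der cont assms)+
  then show ?thesis by (simp add: f1_def[abs_def])
qed

subsection \<open>Prolongation through the Hessian of the generating function\<close>

definition tvec :: "J2 \<Rightarrow> 4 \<Rightarrow> J1" where
  "tvec w i = (axis i 1, snd (snd (fst w)) $ i, \<chi> l. snd w $ Upair i l)"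

definition sym_vec :: "(4 \<Rightarrow> 4 \<Rightarrow> real) \<Rightarrow> real^(4 uprod)" where
  "sym_vec \<eta> = (\<Sum>i\<in>UNIV. \<Sum>j | i \<le> j. \<eta> i j *\<^sub>R axis (Upair i j) 1)"

text \<open>Summation over i \<le> j meets every unordered pair once, and symmetry of
  \<open>\<eta>\<close> covers the other order. Since 4 = 0 is the least index, the pair {1, 4} is
  met as (4, 1).\<close>

lemma sym_vec_nth:
  assumes "\<And>i j. \<eta> i j = \<eta> j i"
  shows "sym_vec \<eta> $ Upair a b = \<eta> a b"
proof -
  have le: "sym_vec \<eta> $ Upair a b = \<eta> a b" if "a \<le> b" for a b
  proof -
    have "sym_vec \<eta> $ Upair a b =
        (\<Sum>i\<in>UNIV. \<Sum>j | i \<le> j. if i = a \<and> j = b then \<eta> i j else 0)"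
      unfolding sym_vec_def sum_component
      by (intro sum.cong refl) (use that in \<open>auto simp: axis_def\<close>)
    also have "\<dots> = (\<Sum>i\<in>UNIV. if i = a then \<eta> a b else 0)"
      by (intro sum.cong refl) (use that in \<open>auto simp: sum.delta\<close>)
    finally show ?thesis by simp
  qed
  show ?thesis
  proof (cases "a \<le> b")
    case False
    then have "sym_vec \<eta> $ Upair b a = \<eta> b a" by (intro le) simp
    moreover have "Upair a b = Upair b a" by simp
    ultimately show ?thesis using assms[of a b] by metis
  qed (rule le)
qed

lemma UNIV_uprod_4:
  "(UNIV :: 4 uprod set) = {Upair 1 1, Upair 1 2, Upair 1 3, Upair 1 4, Upair 2 2, Upair 2 3,
    Upair 2 4, Upair 3 3, Upair 3 4, Upair 4 4}"
proof -
  have "P \<in> {Upair 1 1, Upair 1 2, Upair 1 3, Upair 1 4, Upair 2 2, Upair 2 3,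
    Upair 2 4, Upair 3 3, Upair 3 4, Upair 4 4}" for P :: "4 uprod"
  proof (cases P)
    case (Upair a b)
    then show ?thesis using exhaust_4[of a] exhaust_4[of b] by auto
  qed
  then show ?thesis by blast
qed

lemma sum_uprod_4:
  "(\<Sum>P\<in>UNIV. f (P :: 4 uprod)) = f (Upair 1 1) + f (Upair 1 2) + f (Upair 1 3) + f (Upair 1 4)
    + f (Upair 2 2) + f (Upair 2 3) + f (Upair 2 4) + f (Upair 3 3) + f (Upair 3 4)
    + f (Upair 4 4)"
  unfolding UNIV_uprod_4 by (simp add: add.assoc)

lemma linear_uprod_expansion:
  fixes L :: "real^(4 uprod) \<Rightarrow> real"
  assumes "linear L"
  shows "L h = (\<Sum>P\<in>UNIV. L (axis P 1) * h $ P)"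
proof -
  have "L h = L (\<Sum>P\<in>UNIV. h $ P *\<^sub>R axis P 1)"
    using basis_expansion[of h] by (simp add: scalar_mult_eq_scaleR)
  also have "\<dots> = (\<Sum>P\<in>UNIV. L (axis P 1) * h $ P)"
    by (simp add: linear_sum[OF assms] linear_cmul[OF assms] mult.commute)
  finally show ?thesis .
qed

lemma total_derivative_eq:
  assumes "(g has_derivative g') (at (fst w))"
  shows "total_derivative i g w = g' (tvec w i)"
  using frechet_derivative_at[OF assms]
  by (cases w) (auto simp: total_derivative_def tvec_def split: prod.splits)

lemma contact_field_eq:
  assumes "(f has_derivative f') (at q)"
  shows "contact_field f q = (\<chi> i. - f' (0, 0, axis i 1),
    f q - (\<Sum>i\<in>UNIV. snd (snd q) $ i * f' (0, 0, axis i 1)),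
    \<chi> i. f' (axis i 1, snd (snd q) $ i, 0))"
  using frechet_derivative_at[OF assms] by (cases q) (simp add: contact_field_def Let_def)

text \<open>Encodes f_u = 0, a property shared by the generating functions of all six
  algebras.\<close>

definition u_free :: "(J1 \<Rightarrow> J1 \<Rightarrow> real) \<Rightarrow> bool" where
  "u_free f' \<longleftrightarrow> (\<forall>q. f' q (0, 1, 0) = 0)"

definition has_hessian :: "(J1 \<Rightarrow> real) \<Rightarrow> (J1 \<Rightarrow> J1 \<Rightarrow> J1 \<Rightarrow> real) \<Rightarrow> bool" where
  "has_hessian f B \<longleftrightarrow> (\<exists>f'. jet2 f f' B \<and> u_free f')"

definition hess_vec :: "J2 \<Rightarrow> (J1 \<Rightarrow> J1 \<Rightarrow> J1 \<Rightarrow> real) \<Rightarrow> real^(4 uprod)" where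
  "hess_vec w B = sym_vec (\<lambda>i j. B (fst w) (tvec w i) (tvec w j))"

lemma hess_vec_nth:
  "has_hessian f B \<Longrightarrow> hess_vec w B $ Upair i j = B (fst w) (tvec w i) (tvec w j)"
  unfolding hess_vec_def has_hessian_def jet2_def by (subst sym_vec_nth) blast+

text \<open>With f_u = 0 the contact field has components -f_{u_k} along x_k and f_{x_i} along u_i,
  so the prolongation formula gives D_j f_{x_i} + u_ik D_j f_{u_k}. This is f'' applied to T_j and
  to T_i stripped of its component along u, and that component is invisible to f''.\<close>

lemma prolong_contact_field:
  assumes "has_hessian f f''"
  shows "prolong (contact_field f) w = (contact_field f (fst w), hess_vec w f'')"
proof -
  obtain f' where jet: "jet2 f f' f''" and free: "u_free f'"
    using assms unfolding has_hessian_def by blast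
  let ?q = "fst w"
  have f: "(f has_derivative f' q) (at q)" and f': "((\<lambda>q. f' q v) has_derivative f'' q v) (at q)"
    and sym: "f'' q v v' = f'' q v' v" for q v v'
    using jet unfolding jet2_def by blast+
  have lin: "linear (f' q)" "linear (f'' q v)" for q v
    using f f' has_derivative_linear by blast+
  \<comment> \<open>By \<open>u_free\<close> the derivative of \<open>f\<close> along u is
    identically zero, hence so is its own derivative.\<close>
  have u0: "f'' q (0, 1, 0) v = 0" for q v
  proof -
    have "((\<lambda>q. 0) has_derivative f'' q (0, 1, 0)) (at q)"
      using f'[of "(0, 1, 0)" q] unfolding free[unfolded u_free_def, rule_format] .
    then show ?thesis
      using has_derivative_unique has_derivative_const by metis
  qed
  have free0: "f' q (0, 1, 0) = 0" for q
    using free unfolding u_free_def by blast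
  have split: "(a, b, c) = (a, 0, 0) + b *\<^sub>R (0, 1, 0) + (0, 0, c)" for a c :: "real^4" and b :: real
    by simp
  have x: "snd (snd (contact_field f q)) $ i = f' q (axis i 1, 0, 0)" for q i
    unfolding contact_field_eq[OF f]
    by (simp, subst split)
      (simp add: free0 linear_add[OF lin(1)] linear_cmul[OF lin(1)] linear_0[OF lin(1)]
        del: add_Pair scaleR_Pair flip: zero_prod_def)
  have p: "fst (contact_field f q) $ k = - f' q (0, 0, axis k 1)" for q k
    unfolding contact_field_eq[OF f] by simp
  have expand: "f'' q v (0, 0, c) = (\<Sum>k\<in>UNIV. c $ k * f'' q v (0, 0, axis k 1))" for q v c
  proof -
    have "linear (\<lambda>c. f'' q v (0, 0, c))"
      by (rule linear_compose[OF _ lin(2), unfolded o_def]) (auto intro!: linearI)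
    then show ?thesis
      using basis_expansion[of c] linear_sum[of "\<lambda>c. f'' q v (0, 0, c)"] linear_cmul
      by (smt (verit, ccfv_SIG) real_scaleR_def scalar_mult_eq_scaleR sum.cong)
  qed
  have eta: "total_derivative j (\<lambda>q. snd (snd (contact_field f q)) $ i) w
      - (\<Sum>k\<in>UNIV. snd w $ Upair i k * total_derivative j (\<lambda>q. fst (contact_field f q) $ k) w)
    = f'' ?q (tvec w i) (tvec w j)" for i j
  proof -
    have "total_derivative j (\<lambda>q. snd (snd (contact_field f q)) $ i) w
        = f'' ?q (axis i 1, 0, 0) (tvec w j)"
      unfolding x by (rule total_derivative_eq[OF f'])
    moreover have "total_derivative j (\<lambda>q. fst (contact_field f q) $ k) w
        = - f'' ?q (0, 0, axis k 1) (tvec w j)" for k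
      unfolding p by (rule total_derivative_eq[OF has_derivative_minus[OF f']])
    moreover have "f'' ?q (tvec w i) (tvec w j) = f'' ?q (axis i 1, 0, 0) (tvec w j)
        + (\<Sum>k\<in>UNIV. snd w $ Upair i k * f'' ?q (0, 0, axis k 1) (tvec w j))"
    proof -
      have "f'' ?q (tvec w j) (tvec w i) = f'' ?q (tvec w j) (axis i 1, 0, 0)
        + snd (snd ?q) $ i * f'' ?q (tvec w j) (0, 1, 0)
        + f'' ?q (tvec w j) (0, 0, \<chi> l. snd w $ Upair i l)"
        unfolding tvec_def[of w i]
        by (subst split) (simp only: linear_add[OF lin(2)] linear_cmul[OF lin(2)] real_scaleR_def)
      then show ?thesis
        using expand[of ?q "tvec w j" "\<chi> l. snd w $ Upair i l"]
        by (simp add: sym[of ?q "tvec w j"] u0)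
    qed
    ultimately show ?thesis by (simp add: sum_negf)
  qed
  show ?thesis
    using eta unfolding prolong_def hess_vec_def sym_vec_def by (cases w) simp
qed

subsection \<open>Functional dependence\<close>

text \<open>Since \<open>J\<close> is affine along \<open>e\<close>, sliding \<open>w\<close> along
  \<open>e\<close> to the level J = s is an explicit map \<open>\<psi> s\<close>. For fixed s its
  image lies in one level set of \<open>J\<close>, along which dI vanishes by \<open>ker\<close>, so
  \<open>I (\<psi> s w)\<close> does not depend on \<open>w\<close> near \<open>w0\<close>. For s =
  J w the point is not moved at all, whence I w = F (J w) with
  \<open>F s = I (\<psi> s w0)\<close>.\<close>

lemma locally_function_of_pivot:
  fixes J :: "'a::euclidean_space \<Rightarrow> real"
  assumes U: "open U" "smooth_on U I" and J: "smooth_on U J" and c: "smooth_on U c"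
    and aff: "\<And>w h. J (w + h *\<^sub>R e) = J w + h * c w" and nz: "\<And>w. w \<in> U \<Longrightarrow> c w \<noteq> 0"
    and ker: "\<And>w v. w \<in> U \<Longrightarrow> frechet_derivative J (at w) v = 0 \<Longrightarrow>
      frechet_derivative I (at w) v = 0"
  shows "locally_function_of U I J"
  unfolding locally_function_of_def
proof
  fix w0 assume w0: "w0 \<in> U"
  define \<psi> where "\<psi> s w = w + ((s - J w) / c w) *\<^sub>R e" for s w
  have J\<psi>: "J (\<psi> s w) = s" if "w \<in> U" for s w
    using nz[OF that] by (simp add: \<psi>_def aff)
  have \<psi>J: "\<psi> (J w) w = w" for w by (simp add: \<psi>_def)
  \<comment> \<open>Openness of \<open>\<Omega>\<close> yields neighbourhoods of J w0 and of
    \<open>w0\<close> for which \<open>\<psi>\<close> never leaves \<open>U\<close>, the region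
    where \<open>I\<close> is smooth and \<open>ker\<close> applies.\<close>
  define \<Omega> where "\<Omega> = (UNIV \<times> U) \<inter> (\<lambda>z. \<psi> (fst z) (snd z)) -` U"
  have "open \<Omega>"
    unfolding \<Omega>_def \<psi>_def
    by (intro continuous_open_preimage continuous_intros
        continuous_on_compose2[OF smooth_on_continuous_on[OF J]]
        continuous_on_compose2[OF smooth_on_continuous_on[OF c]] open_Times U(1))
      (auto simp: nz)
  moreover have "(J w0, w0) \<in> \<Omega>" using w0 by (simp add: \<Omega>_def \<psi>J)
  ultimately obtain A B where "open A" "open B" "(J w0, w0) \<in> A \<times> B" "A \<times> B \<subseteq> \<Omega>"
    by (rule open_prod_elim)
  then have AB: "open A" "open B" "J w0 \<in> A" "w0 \<in> B" "A \<times> B \<subseteq> \<Omega>"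
    by auto
  have "open (U \<inter> J -` A)"
    using continuous_open_preimage[OF smooth_on_continuous_on[OF J] U(1) AB(1)] .
  then have "open (U \<inter> J -` A \<inter> B)" using AB(2) by blast
  then obtain r where r: "0 < r" "ball w0 r \<subseteq> U \<inter> J -` A \<inter> B"
    using w0 AB by (metis IntI open_contains_ball vimageI2)
  have in_U: "\<psi> s w \<in> U" if "s \<in> A" "w \<in> ball w0 r" for s w
  proof -
    have "(s, w) \<in> A \<times> B" using that r by auto
    then have "(s, w) \<in> \<Omega>" using AB(5) by blast
    then show ?thesis by (simp add: \<Omega>_def)
  qed
  define F where "F s = I (\<psi> s w0)" for s
  \<comment> \<open>The point \<open>\<psi> s w0\<close> depends on s affinely, so \<open>F\<close>
    is \<open>I\<close> after an affine substitution.\<close>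
  have "smooth_on A (\<lambda>s. I ((w0 - (J w0 / c w0) *\<^sub>R e) + s *\<^sub>R ((1 / c w0) *\<^sub>R e)))"
  proof (rule smooth_on_affine_comp[OF U(2) U(1) AB(1)])
    fix s assume "s \<in> A"
    then have "\<psi> s w0 \<in> U" using in_U r by simp
    then show "(w0 - (J w0 / c w0) *\<^sub>R e) + s *\<^sub>R ((1 / c w0) *\<^sub>R e) \<in> U"
      by (simp add: \<psi>_def diff_divide_distrib scaleR_diff_left algebra_simps)
  qed (rule bounded_linear_scaleR_left)
  then have smF: "smooth_on A F"
    by (simp add: F_def[abs_def] \<psi>_def diff_divide_distrib scaleR_diff_left algebra_simps)
  have const: "I (\<psi> s v) = I (\<psi> s w0)" if s: "s \<in> A" and v: "v \<in> ball w0 r" for s v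
  proof -
    have "((\<lambda>w. I (\<psi> s w)) has_derivative (\<lambda>_. 0)) (at w within ball w0 r)"
      if w: "w \<in> ball w0 r" for w
    proof -
      have wU: "w \<in> U" using r w by auto
      note der = smooth_on_has_derivative[OF J wU] smooth_on_has_derivative[OF c wU]
      have "\<exists>P. (\<psi> s has_derivative P) (at w)"
        unfolding \<psi>_def
        by (intro exI, (rule derivative_intros der nz[OF wU] Deriv.has_derivative_divide)+)
      then obtain P where P: "(\<psi> s has_derivative P) (at w)" by blast
      note \<psi>U = in_U[OF s w]
      have "((\<lambda>w. J (\<psi> s w)) has_derivative (\<lambda>v. frechet_derivative J (at (\<psi> s w)) (P v))) (at w)"
        using has_derivative_compose[OF P smooth_on_has_derivative[OF J \<psi>U]] .
      \<comment> \<open>\<open>J\<close> has the constant value s on the image of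
        \<open>\<psi> s\<close>; uniqueness of derivatives therefore puts every \<open>P v\<close>
        into the kernel of dJ.\<close>
      moreover have "((\<lambda>w. J (\<psi> s w)) has_derivative (\<lambda>_. 0)) (at w)"
        by (rule has_derivative_transform_within_open[OF has_derivative_const U(1) wU])
          (simp add: J\<psi>)
      ultimately have "frechet_derivative J (at (\<psi> s w)) (P v) = 0" for v
        using has_derivative_unique by metis
      then have "(\<lambda>v. frechet_derivative I (at (\<psi> s w)) (P v)) = (\<lambda>_. 0)"
        using ker[OF \<psi>U] by auto
      then show ?thesis
        using has_derivative_compose[OF P smooth_on_has_derivative[OF U(2) \<psi>U]]
        by (simp add: has_derivative_at_withinI)
    qed
    then obtain k where "\<And>w. w \<in> ball w0 r \<Longrightarrow> I (\<psi> s w) = k"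
      using has_derivative_zero_constant[OF convex_ball] by metis
    then show ?thesis using v r by simp
  qed
  show "\<exists>V W F. open V \<and> w0 \<in> V \<and> V \<subseteq> U \<and> open W \<and> J ` V \<subseteq> W \<and>
      smooth_on W F \<and> (\<forall>v\<in>V. I v = F (J v))"
  proof (intro exI conjI ballI)
    show "I v = F (J v)" if "v \<in> ball w0 r" for v
      using const[of "J v" v] that r unfolding \<psi>J F_def by auto
  qed (use r AB smF in auto)
qed

text \<open>The affine section y \<mapsto> w0 - R (G w0) + R y passes through \<open>w0\<close> and
  meets every fibre of \<open>G\<close>. A point and the section point of its fibre differ by a
  kernel vector; inside a ball the segment between them stays in \<open>U\<close>, and
  \<open>I\<close> is constant on it.\<close>

lemma locally_function_of_linear:
  fixes G :: "'a::euclidean_space \<Rightarrow> 'b::euclidean_space"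
  assumes U: "open U" "smooth_on U I" and G: "bounded_linear G" and R: "bounded_linear R"
    and GR: "\<And>y. G (R y) = y"
    and ker: "\<And>w v. w \<in> U \<Longrightarrow> G v = 0 \<Longrightarrow> frechet_derivative I (at w) v = 0"
  shows "locally_function_of U I G"
  unfolding locally_function_of_def
proof
  interpret G: bounded_linear G by (rule G)
  interpret R: bounded_linear R by (rule R)
  fix w0 assume w0: "w0 \<in> U"
  then obtain r where r: "0 < r" "ball w0 r \<subseteq> U"
    using U(1) open_contains_ball by blast
  define W where "W = (\<lambda>y. (w0 - R (G w0)) + R y) -` ball w0 r"
  have "continuous_on UNIV (\<lambda>y. (w0 - R (G w0)) + R y)"
    by (intro continuous_intros R.continuous_on)
  then have W: "open W" unfolding W_def by (intro open_vimage) auto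
  define V where "V = ball w0 r \<inter> G -` W"
  have "open V" unfolding V_def
    using W G.continuous_on[OF continuous_on_id] by (intro open_Int open_vimage) auto
  have smF: "smooth_on W (\<lambda>y. I ((w0 - R (G w0)) + R y))"
    using r by (intro smooth_on_affine_comp[OF U(2,1) W R]) (auto simp: W_def)
  have eq: "I v = I ((w0 - R (G w0)) + R (G v))" if v: "v \<in> V" for v
  proof -
    define d where "d = (w0 - R (G w0)) + R (G v) - v"
    have Gd: "G d = 0" by (simp add: d_def G.add G.diff GR)
    have seg: "v + t *\<^sub>R d \<in> ball w0 r" if "t \<in> {0..1}" for t
    proof -
      have "v \<in> ball w0 r" "v + d \<in> ball w0 r"
        using v by (auto simp: V_def W_def d_def)
      then have "(1 - t) *\<^sub>R v + t *\<^sub>R (v + d) \<in> ball w0 r"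
        using that by (intro convexD[OF convex_ball]) auto
      then show ?thesis by (simp add: algebra_simps)
    qed
    have "((\<lambda>t. I (v + t *\<^sub>R d)) has_derivative (\<lambda>_. 0)) (at t within {0..1})"
      if "t \<in> {0..1}" for t
    proof -
      have tU: "v + t *\<^sub>R d \<in> U" using seg[OF that] r by auto
      have "((\<lambda>t. I (v + t *\<^sub>R d)) has_derivative
          (\<lambda>s. frechet_derivative I (at (v + t *\<^sub>R d)) (s *\<^sub>R d))) (at t within {0..1})"
        by (rule has_derivative_compose[where f="\<lambda>t. v + t *\<^sub>R d", OF _ smooth_on_has_derivative[OF U(2) tU]])
          (auto intro!: derivative_eq_intros)
      moreover have "frechet_derivative I (at (v + t *\<^sub>R d)) (s *\<^sub>R d) = 0" for s
        by (rule ker[OF tU]) (simp add: G.scaleR Gd)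
      ultimately show ?thesis by simp
    qed
    then obtain k where "\<And>t. t \<in> {0..1} \<Longrightarrow> I (v + t *\<^sub>R d) = k"
      using has_derivative_zero_constant[of "{0..1::real}"] by (metis convex_real_interval(5))
    from this[of 0] this[of 1] show ?thesis by (simp add: d_def)
  qed
  show "\<exists>V W F. open V \<and> w0 \<in> V \<and> V \<subseteq> U \<and> open W \<and> G ` V \<subseteq> W \<and>
      smooth_on W F \<and> (\<forall>v\<in>V. I v = F (G v))"
    by (rule exI[of _ V], rule exI[of _ W], rule exI[of _ "\<lambda>y. I ((w0 - R (G w0)) + R y)"])
      (use \<open>open V\<close> W smF eq r in \<open>auto simp: V_def W_def\<close>)
qed

lemma dense_Int:
  assumes "open A" "closure A = UNIV" "closure B = UNIV"
  shows "closure (A \<inter> B) = UNIV"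
  using open_Int_closure_subset[OF assms(1), of B] assms closure_minimal[of A "closure (A \<inter> B)"]
  by auto

text \<open>At a zero of \<open>J\<close> with c w \<noteq> 0 the values J (w + h e) = h c w are
  non-zero for h \<noteq> 0, so the point is a limit of non-zeros of \<open>J\<close>.\<close>

lemma dense_nonzero:
  fixes J :: "'a::real_normed_vector \<Rightarrow> real"
  assumes aff: "\<And>w h. J (w + h *\<^sub>R e) = J w + h * c w" and c: "closure {w. c w \<noteq> 0} = UNIV"
  shows "closure {w. J w \<noteq> 0} = UNIV"
proof -
  have "w \<in> closure {w. J w \<noteq> 0}" if cw: "c w \<noteq> 0" for w
  proof (cases "J w = 0")
    case True
    have "(\<lambda>n. w + inverse (real (Suc n)) *\<^sub>R e) \<longlonglongrightarrow> w + 0 *\<^sub>R e"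
      by (intro tendsto_intros LIMSEQ_inverse_real_of_nat)
    moreover have "J (w + inverse (real (Suc n)) *\<^sub>R e) \<noteq> 0" for n
      using True cw unfolding aff by simp
    ultimately show ?thesis unfolding closure_sequential
      by (intro exI[of _ "\<lambda>n. w + inverse (real (Suc n)) *\<^sub>R e"]) auto
  next
    case False
    then show ?thesis using closure_subset[of "{w. J w \<noteq> 0}"] by auto
  qed
  then have "closure {w. c w \<noteq> 0} \<subseteq> closure {w. J w \<noteq> 0}"
    by (intro closure_minimal) auto
  then show ?thesis using c by auto
qed

subsection \<open>Algebras containing the Heisenberg algebra\<close>

definition heisenberg :: "(J1 \<Rightarrow> real) set" where
  "heisenberg = insert (\<lambda>q. 1) (range (\<lambda>i q. fst q $ i) \<union> range (\<lambda>i q. snd (snd q) $ i))"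

lemma bounded_linear_x: "bounded_linear (\<lambda>q::J1. fst q $ i)"
  and bounded_linear_p: "bounded_linear (\<lambda>q::J1. snd (snd q) $ i)"
  by (auto intro!: bounded_linear_intros bounded_linear_compose[OF bounded_linear_vec_nth])

lemma jet2_linear_J1:
  "jet2 (\<lambda>q::J1. fst q $ i) (\<lambda>q v. fst v $ i) (\<lambda>q v w. 0)"
  "jet2 (\<lambda>q::J1. snd (snd q) $ i) (\<lambda>q v. snd (snd v) $ i) (\<lambda>q v w. 0)"
  by (rule jet2_bounded_linear bounded_linear_x bounded_linear_p)+

lemma contact_field_1: "contact_field (\<lambda>q. 1) q = (0, 1, 0)"
  by (subst contact_field_eq[OF has_derivative_const]) (simp add: vec_eq_iff)

lemma contact_field_x: "contact_field (\<lambda>q. fst q $ i) q = (0, fst q $ i, axis i 1)"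
  by (subst contact_field_eq[OF bounded_linear_imp_has_derivative[OF bounded_linear_x]])
    (simp add: vec_eq_iff axis_def)

lemma contact_field_p: "contact_field (\<lambda>q. snd (snd q) $ i) q = (- axis i 1, 0, 0)"
  by (subst contact_field_eq[OF bounded_linear_imp_has_derivative[OF bounded_linear_p]])
    (auto simp: vec_eq_iff axis_def if_distrib[of "\<lambda>x. _ * x"] cong: if_cong)

lemma linear_vec_0:
  fixes L :: "real^4 \<Rightarrow> real"
  assumes "linear L" "\<And>i. L (axis i 1) = 0"
  shows "L x = 0"
proof -
  have "L x = L (\<Sum>i\<in>UNIV. x $ i *\<^sub>R axis i 1)"
    using basis_expansion[of x] by (simp add: scalar_mult_eq_scaleR)
  then show ?thesis by (simp add: linear_sum[OF assms(1)] linear_cmul[OF assms(1)] assms(2))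
qed

text \<open>At each point the fields of 1, x_i, u_i take the values d_u, x_i d_u + d_{u_i},
  -d_{x_i}, which span the tangent space of \<open>J1\<close>.\<close>

lemma heisenberg_kernel:
  assumes lin: "linear L" and S: "heisenberg \<subseteq> S"
    and L: "\<And>f. f \<in> S \<Longrightarrow> L (contact_field f q) = 0"
  shows "L v = (0::real)"
proof -
  have 1: "L (0, 1, 0) = 0" and x: "L (0, fst q $ i, axis i 1) = 0" and p: "L (- axis i 1, 0, 0) = 0" for i
    using S L[of "\<lambda>q. 1"] L[of "\<lambda>q. fst q $ i"] L[of "\<lambda>q. snd (snd q) $ i"]
    by (auto simp: heisenberg_def contact_field_1 contact_field_x contact_field_p)
  have u: "L (0, b, 0) = 0" for b
    using linear_cmul[OF lin, of b "(0, 1, 0)"] 1 by simp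
  have "L (axis i 1, 0, 0) = 0" for i
    using linear_neg[OF lin, of "(- axis i 1, 0, 0)"] p by simp
  then have a: "L (a, 0, 0) = 0" for a
    by (rule linear_vec_0[of "\<lambda>a. L (a, 0, 0)", rotated])
      (auto intro!: linearI simp flip: linear_add[OF lin] linear_cmul[OF lin, unfolded real_scaleR_def])
  have "L (0, 0, axis i 1) = 0" for i
    using linear_diff[OF lin, of "(0, fst q $ i, axis i 1)" "(0, fst q $ i, 0)"] x u by simp
  then have c: "L (0, 0, c) = 0" for c
    by (rule linear_vec_0[of "\<lambda>a. L (0, 0, a)", rotated])
      (auto intro!: linearI simp flip: linear_add[OF lin] linear_cmul[OF lin, unfolded real_scaleR_def])
  obtain x b y where v: "v = (x, b, y)" by (cases v) auto
  have "L v = L ((x, 0, 0) + (0, b, 0) + (0, 0, y))" by (simp add: v)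
  then show ?thesis by (simp only: linear_add[OF lin] a u c)
qed

lemma no_diff_invariants1I:
  assumes "heisenberg \<subseteq> S"
  shows "no_diff_invariants1 S"
  unfolding no_diff_invariants1_def diff_invariant1_def invariant_on_def
proof (intro allI impI ballI, elim conjE)
  fix U I q assume U: "open U" "smooth_on U I" "q \<in> U"
    and inv: "\<forall>X\<in>contact_field ` S. \<forall>w\<in>U. lie_derivative X I w = 0"
  obtain r where r: "0 < r" "ball q r \<subseteq> U" using U open_contains_ball by blast
  have "(I has_derivative (\<lambda>_. 0)) (at w within ball q r)" if "w \<in> ball q r" for w
  proof -
    have w: "w \<in> U" using r that by auto
    note d = smooth_on_has_derivative[OF U(2) w]
    have "frechet_derivative I (at w) v = 0" for v
      by (rule heisenberg_kernel[OF has_derivative_linear[OF d] assms, of w])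
        (use inv w in \<open>auto simp: lie_derivative_def\<close>)
    then have "frechet_derivative I (at w) = (\<lambda>_. 0)" by blast
    then show ?thesis using d has_derivative_at_withinI by metis
  qed
  then have "I constant_on ball q r"
    using has_derivative_zero_constant[OF convex_ball] unfolding constant_on_def by metis
  then show "\<exists>V. open V \<and> q \<in> V \<and> V \<subseteq> U \<and> I constant_on V"
    using r by (intro exI[of _ "ball q r"]) auto
qed

text \<open>The candidates for the differential of an invariant in the u_ij directions, once its
  components along \<open>J1\<close> are known to vanish.\<close>

definition annihilator :: "(J1 \<Rightarrow> real) set \<Rightarrow> J2 \<Rightarrow> (real^(4 uprod) \<Rightarrow> real) set" where
  "annihilator S w = {L. linear L \<and> (\<forall>f B. f \<in> S \<longrightarrow> has_hessian f B \<longrightarrow> L (hess_vec w B) = 0)}"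

text \<open>Here \<open>j w\<close> is the differential of \<open>J\<close> on Hessians, and
  \<open>E\<close> is the dense open part of the domain on which every annihilating functional
  vanishes on the kernel of \<open>j w\<close> and the pivot coefficient \<open>c\<close> along
  \<open>e\<close> is non-zero. Each case is thereby reduced to an identity (\<open>inv\<close>) and
  to linear algebra at a point (\<open>trans\<close>).\<close>

lemma only_diff_invariant2I:
  assumes S: "heisenberg \<subseteq> S"
    and D: "open D" and J: "smooth_on D J"
    and J': "\<And>w. w \<in> D \<Longrightarrow> (J has_derivative (\<lambda>v. j w (snd v))) (at w)"
    and inv: "\<And>f w. f \<in> S \<Longrightarrow> w \<in> D \<Longrightarrow> \<exists>B. has_hessian f B \<and> j w (hess_vec w B) = 0"
    and E: "open E" "closure E = UNIV" "E \<subseteq> D"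
    and trans: "\<And>w L h. w \<in> E \<Longrightarrow> L \<in> annihilator S w \<Longrightarrow> j w h = 0 \<Longrightarrow> L h = 0"
    and aff: "\<And>w h. J (w + h *\<^sub>R e) = J w + h * c w" and c: "smooth_on E c"
    and nz: "\<And>w. w \<in> E \<Longrightarrow> c w \<noteq> 0"
  shows "only_diff_invariant2 S D J"
  unfolding only_diff_invariant2_def
proof (intro conjI allI impI)
  show "closure D = UNIV" using E closure_mono[of E D] by auto
  have "lie_derivative (prolong (contact_field f)) J w = 0" if fw: "f \<in> S" "w \<in> D" for f w
  proof -
    obtain B where *: "has_hessian f B" "j w (hess_vec w B) = 0"
      using inv[OF fw] by blast
    show ?thesis
      unfolding lie_derivative_def prolong_contact_field[OF *(1)]
      using frechet_derivative_at[OF J'[OF fw(2)]] *(2) by (metis snd_conv)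
  qed
  then show "diff_invariant2 S D J"
    using D J unfolding diff_invariant2_def invariant_on_def by auto
  fix U I assume "diff_invariant2 S U I"
  then have U: "open U" "smooth_on U I"
    and lie: "\<And>f w. f \<in> S \<Longrightarrow> w \<in> U \<Longrightarrow> lie_derivative (prolong (contact_field f)) I w = 0"
    by (auto simp: diff_invariant2_def invariant_on_def)
  have mono: "smooth_on B g" if "smooth_on A g" "B \<subseteq> A" for A B and g :: "J2 \<Rightarrow> real"
  proof -
    have "Ck_on k A g \<Longrightarrow> Ck_on k B g" for k
      using that(2) by (induction k arbitrary: g) (auto intro: continuous_on_subset)
    then show ?thesis using that(1) by (simp add: smooth_on_def)
  qed
  have "locally_function_of (U \<inter> E) I J"
  proof (rule locally_function_of_pivot[where c=c and e=e])
    show "smooth_on (U \<inter> E) I" "smooth_on (U \<inter> E) J" "smooth_on (U \<inter> E) c"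
      using E by (auto intro: mono[OF U(2)] mono[OF J] mono[OF c])
    fix w v assume w: "w \<in> U \<inter> E" and v: "frechet_derivative J (at w) v = 0"
    define L where "L = frechet_derivative I (at w)"
    have lin: "linear L"
      unfolding L_def using smooth_on_has_derivative[OF U(2)] w has_derivative_linear by blast
    have lin1: "linear (\<lambda>a. L (a, 0))" and lin2: "linear (\<lambda>a. L (0, a))"
      by (auto intro!: linearI simp flip: linear_add[OF lin] linear_cmul[OF lin, unfolded real_scaleR_def])
    have split: "L (a, b) = L (a, 0) + L (0, b)" for a b
      using linear_add[OF lin, of "(a, 0)" "(0, b)"] by simp
    have L0: "L (contact_field f (fst w), hess_vec w B) = 0"
      if "f \<in> S" "has_hessian f B" for f B
      using lie[OF that(1), of w] w
      unfolding lie_derivative_def prolong_contact_field[OF that(2)] L_def by auto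
    have s0: "hess_vec w (\<lambda>q v w. 0) = 0" by (simp add: hess_vec_def sym_vec_def)
    \<comment> \<open>Linear generating functions have zero Hessian, so for them invariance only
      tests the components of dI along \<open>J1\<close>.\<close>
    have "L (contact_field f (fst w), 0) = 0" if "f \<in> heisenberg" for f
    proof -
      have "has_hessian f (\<lambda>q v w. 0)"
        using that jet2_const[of 1] jet2_linear_J1
        unfolding heisenberg_def has_hessian_def by (fastforce simp: u_free_def)
      then show ?thesis using L0[of f] that S s0 by fastforce
    qed
    then have L1: "L (a, 0) = 0" for a
      using heisenberg_kernel[OF lin1, of heisenberg "fst w"] by blast
    have "L (0, snd v) = 0"
    proof (rule trans)
      show "w \<in> E" using w by simp
      show "(\<lambda>a. L (0, a)) \<in> annihilator S w"
        unfolding annihilator_def mem_Collect_eq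
      proof (intro conjI lin2 allI impI)
        show "L (0, hess_vec w B) = 0" if "f \<in> S" "has_hessian f B" for f B
          using L0[OF that] split[of "contact_field f (fst w)" "hess_vec w B"] L1 by simp
      qed
      have "(J has_derivative (\<lambda>v. j w (snd v))) (at w)" using J' w E by blast
      then show "j w (snd v) = 0" using v frechet_derivative_at by metis
    qed
    then show "frechet_derivative I (at w) v = 0"
      using split[of "fst v" "snd v"] L1 by (simp add: L_def)
  qed (use U E aff nz in auto)
  moreover have "U \<subseteq> closure (U \<inter> E)"
    using open_Int_closure_subset[OF U(1), of E] E by simp
  ultimately show "generically_function_of U I D J"
    unfolding generically_function_of_def using U E by (intro exI[of _ "U \<inter> E"]) auto
qed

subsection \<open>Hessians of functions of two coordinates\<close>

lemma smooth_on_D: "smooth_on UNIV A \<Longrightarrow> smooth_on UNIV (D1 A)" "smooth_on UNIV A \<Longrightarrow> smooth_on UNIV (D2 A)"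
  using smooth_on_frechet_derivative[of UNIV A "(1, 0)"] smooth_on_frechet_derivative[of UNIV A "(0, 1)"]
  by (auto simp: D1_def[abs_def] D2_def[abs_def] Basis_prod_def)

lemma D1_D2_commute:
  assumes "smooth_on UNIV A" shows "D1 (D2 A) = D2 (D1 A)"
  using smooth_on_mixed_derivative_commute[OF assms, of "(0, 1)" "(1, 0)"]
  by (auto simp: fun_eq_iff D1_def[abs_def] D2_def[abs_def] Basis_prod_def)

lemma has_derivative_D:
  assumes "smooth_on UNIV A"
  shows "(A has_derivative (\<lambda>v. D1 A s * fst v + D2 A s * snd v)) (at s)"
proof -
  have d: "(A has_derivative frechet_derivative A (at s)) (at s)"
    using smooth_on_has_derivative[OF assms] by simp
  note lin = has_derivative_linear[OF d]
  have "frechet_derivative A (at s) v = D1 A s * fst v + D2 A s * snd v" for v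
    using linear_add[OF lin, of "fst v *\<^sub>R (1, 0)" "snd v *\<^sub>R (0, 1)"]
    by (simp add: linear_cmul[OF lin] D1_def D2_def mult.commute del: scaleR_Pair)
      (simp add: mult.commute)
  then have "frechet_derivative A (at s) = (\<lambda>v. D1 A s * fst v + D2 A s * snd v)" by blast
  then show ?thesis using d by simp
qed

lemma D_unique:
  assumes "\<And>s. (A has_derivative (\<lambda>v. a s * fst v + b s * snd v)) (at s)"
  shows "D1 A = a" "D2 A = b"
  using frechet_derivative_at[OF assms, symmetric] by (auto simp: D1_def D2_def fun_eq_iff)

text \<open>\<open>D2 (D1 A)\<close> is the normal form of the mixed derivative; with it the
  bilinear form is visibly symmetric, and terms from different parts of a generating function can
  cancel syntactically.\<close>

lemma jet2_plane:
  assumes "smooth_on UNIV A" "bounded_linear l" "bounded_linear m"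
  shows "jet2 (\<lambda>q. A (l q, m q)) (\<lambda>q v. D1 A (l q, m q) * l v + D2 A (l q, m q) * m v)
    (\<lambda>q v w. D1 (D1 A) (l q, m q) * l v * l w + D2 (D1 A) (l q, m q) * (l v * m w + m v * l w)
      + D2 (D2 A) (l q, m q) * m v * m w)"
proof -
  have "jet2 A (\<lambda>s v. D1 A s * fst v + D2 A s * snd v)
    (\<lambda>s v w. D1 (D1 A) s * fst v * fst w + D2 (D1 A) s * (fst v * snd w + snd v * fst w)
      + D2 (D2 A) s * snd v * snd w)"
    unfolding jet2_def
    using has_derivative_D[OF assms(1)]
    by (auto simp: algebra_simps D1_D2_commute[OF assms(1)] intro!: derivative_eq_intros
        has_derivative_D smooth_on_D assms(1))
  from jet2_comp_linear[OF this bounded_linear_Pair[OF assms(2,3)]] show ?thesis by simp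
qed

lemma jet2_diff: "jet2 f f' f'' \<Longrightarrow> jet2 g g' g'' \<Longrightarrow>
    jet2 (\<lambda>q. f q - g q) (\<lambda>q v. f' q v - g' q v) (\<lambda>q v w. f'' q v w - g'' q v w)"
  by (auto simp: jet2_def intro!: has_derivative_diff)

text \<open>\<open>X i\<close> names x_i and \<open>P i\<close> names u_i. As opaque atoms they are
  their own derivatives, and on T_k they take the values \<delta>_ik and u_ki, so that a Hessian
  evaluated on T_i and T_j becomes an expression in the u_ij.\<close>

datatype coordinate = X 4 | P 4

primrec coord :: "coordinate \<Rightarrow> J1 \<Rightarrow> real" where
  "coord (X i) = (\<lambda>q. fst q $ i)"
| "coord (P i) = (\<lambda>q. snd (snd q) $ i)"

lemma bounded_linear_coord: "bounded_linear (coord k)"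
  by (cases k) (auto simp: bounded_linear_x bounded_linear_p)

lemma coord_tvec [simp]: "coord (X i) (tvec w k) = (if i = k then 1 else 0)" "coord (P i) (tvec w k) = uu k i w"
  by (auto simp: tvec_def axis_def uu_def)

lemma coord_0_1_0 [simp]: "coord k (0, 1, 0) = 0"
  by (cases k) auto

lemmas jet2_coord = jet2_bounded_linear[OF bounded_linear_coord]

lemmas jet2_plane_coord = jet2_plane[OF _ bounded_linear_coord bounded_linear_coord]

lemma uu_commute [simp]: "uu 2 1 w = uu 1 2 w" "uu 3 1 w = uu 1 3 w" "uu 4 1 w = uu 1 4 w"
  "uu 3 2 w = uu 2 3 w" "uu 4 2 w = uu 2 4 w" "uu 4 3 w = uu 3 4 w"
  by (simp_all add: uu_def, (metis Upair_inject)+)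

declare coord.simps [simp del]

section \<open>Quadratic generating functions and the linear equations they impose\<close>

definition quadric :: "(real \<times> coordinate \<times> coordinate) list \<Rightarrow> J1 \<Rightarrow> real" where
  "quadric ms q = (\<Sum>(c, k, l)\<leftarrow>ms. c * (coord k q * coord l q))"

lemma has_hessian_add: "has_hessian f B \<Longrightarrow> has_hessian g C \<Longrightarrow>
    has_hessian (\<lambda>q. f q + g q) (\<lambda>q v w. B q v w + C q v w)"
  unfolding has_hessian_def u_free_def
  by (elim exE conjE, intro exI conjI, rule jet2_add, assumption+) simp

lemma has_hessian_quadric:
  "has_hessian (quadric ms)
    (\<lambda>q v w. \<Sum>(c, k, l)\<leftarrow>ms. c * (coord k v * coord l w + coord k w * coord l v))"
proof (induction ms)
  case Nil
  have "u_free (\<lambda>q v. 0)" by (simp add: u_free_def)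
  then show ?case using jet2_const[of 0] by (auto simp: has_hessian_def quadric_def[abs_def])
next
  case (Cons m ms)
  obtain c k l where m: "m = (c, k, l)" by (cases m)
  have "jet2 (\<lambda>q. c * (coord k q * coord l q))
      (\<lambda>q v. c * (coord k q * coord l v + coord k v * coord l q) + 0 * (coord k q * coord l q))
      (\<lambda>q v w. c * (coord k v * coord l w + coord k w * coord l v))"
    using jet2_mult[OF jet2_const[of c] jet2_mult[OF jet2_coord[of k] jet2_coord[of l]]]
    by (simp add: add.commute)
  then have "has_hessian (\<lambda>q. c * (coord k q * coord l q))
      (\<lambda>q v w. c * (coord k v * coord l w + coord k w * coord l v))"
    unfolding has_hessian_def u_free_def by (auto simp: coord_0_1_0 intro!: exI)
  from has_hessian_add[OF this Cons.IH] show ?case by (simp add: m quadric_def[abs_def])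
qed

text \<open>A quadric has the same Hessian at every point of \<open>J1\<close>, so each one in the
  algebra yields a linear equation for the ten numbers a_ij, with coefficients in the u_ij.
  \<open>\<eta>\<close> and \<open>a\<close> are tied by equations so that \<open>refl\<close> or a
  local definition can instantiate them.\<close>

lemma quadric_relation:
  assumes mem: "quadric ms \<in> S" and L: "L \<in> annihilator S w"
    and \<eta>: "\<And>i j. \<eta> i j = (\<Sum>(c, k, l)\<leftarrow>ms. c * (coord k (tvec w i) * coord l (tvec w j)
      + coord k (tvec w j) * coord l (tvec w i)))"
    and a: "\<And>i j. a i j = L (axis (Upair i j) 1)"
  shows "a 1 1 * \<eta> 1 1 + a 1 2 * \<eta> 1 2 + a 1 3 * \<eta> 1 3 + a 1 4 * \<eta> 1 4 + a 2 2 * \<eta> 2 2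
    + a 2 3 * \<eta> 2 3 + a 2 4 * \<eta> 2 4 + a 3 3 * \<eta> 3 3 + a 3 4 * \<eta> 3 4 + a 4 4 * \<eta> 4 4 = 0"
proof -
  note h = has_hessian_quadric[of ms]
  have "L (hess_vec w (\<lambda>q v w. \<Sum>(c, k, l)\<leftarrow>ms. c * (coord k v * coord l w + coord k w * coord l v))) = 0"
    using L mem h unfolding annihilator_def by blast
  then show ?thesis
    by (subst (asm) linear_uprod_expansion[of L])
      (use L in \<open>simp_all add: annihilator_def sum_uprod_4 hess_vec_nth[OF h] \<eta> a\<close>)
qed

text \<open>The derivatives stay existential, to be filled in by the \<open>jet2\<close> rules.
  \<open>d\<close> acts on matrices so that it applies both to \<open>hess_vec\<close> and to the
  values of \<open>B\<close> on the T_i.\<close>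

lemma hessianI:
  assumes "\<exists>f' B. jet2 f f' B \<and> u_free f' \<and> d (\<lambda>i k. B (fst w) (tvec w i) (tvec w k)) = 0"
  shows "\<exists>B. has_hessian f B \<and> d (\<lambda>i k. hess_vec w B $ Upair i k) = 0"
proof -
  obtain f' B where B: "jet2 f f' B" "u_free f'" "d (\<lambda>i k. B (fst w) (tvec w i) (tvec w k)) = 0"
    using assms by blast
  then have "has_hessian f B" unfolding has_hessian_def by blast
  then show ?thesis using B(3) by (intro exI[of _ B]) (simp add: hess_vec_nth)
qed

text \<open>Quadratic polynomials suffice as parameter functions, since the Heisenberg algebra and the
  quadratic generating functions already have orbits of codimension one.\<close>

definition quad :: "real \<Rightarrow> real \<Rightarrow> real \<Rightarrow> real \<Rightarrow> real \<Rightarrow> real \<Rightarrow> real \<times> real \<Rightarrow> real" where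
  "quad a b c d e f = (\<lambda>s. a + b * fst s + c * snd s + d * (fst s)^2 + e * (fst s * snd s) + f * (snd s)^2)"

lemma quad_Pair: "quad a b c d e f (r, s) = a + b * r + c * s + d * r^2 + e * (r * s) + f * s^2"
  by (simp add: quad_def)

lemma smooth_on_quad: "smooth_on UNIV (quad a b c d e f)"
  unfolding quad_def
  by (intro smooth_on_add smooth_on_mult smooth_on_power smooth_on_const smooth_on_bounded_linear
      bounded_linear_fst bounded_linear_snd open_UNIV)

lemma D_quad: "D1 (quad a b c d e f) = quad b (2 * d) e 0 0 0" "D2 (quad a b c d e f) = quad c e (2 * f) 0 0 0"
  by (rule D_unique[where a="quad b (2 * d) e 0 0 0" and b="quad c e (2 * f) 0 0 0"];
      auto simp: quad_def algebra_simps power2_eq_square intro!: derivative_eq_intros)+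

lemmas quad_simps = smooth_on_quad D_quad quad_Pair quadric_def algebra_simps power2_eq_square

abbreviation "q0 \<equiv> quad 0 0 0 0 0 0"

lemma heisenbergI:
  assumes "(\<lambda>q. 1) \<in> S" "coord (X 1) \<in> S" "coord (X 2) \<in> S" "coord (X 3) \<in> S" "coord (X 4) \<in> S"
    "coord (P 1) \<in> S" "coord (P 2) \<in> S" "coord (P 3) \<in> S" "coord (P 4) \<in> S"
  shows "heisenberg \<subseteq> S"
proof -
  have "coord (X i) \<in> S" "coord (P i) \<in> S" for i
    using assms exhaust_4[of i] by auto
  then have "(\<lambda>q. fst q $ i) \<in> S" "(\<lambda>q. snd (snd q) $ i) \<in> S" for i
    by (simp_all add: coord.simps)
  then show ?thesis using assms(1) unfolding heisenberg_def by blast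
qed

section \<open>The coordinates u_ij as functions on \<open>J2\<close>\<close>

lemma bounded_linear_H: "bounded_linear (\<lambda>w::J2. snd w $ p)"
  by (rule bounded_linear_compose[OF bounded_linear_vec_nth bounded_linear_snd])

lemma has_derivative_uu: "((\<lambda>w. uu i j w) has_derivative (\<lambda>v. snd v $ Upair i j)) (at w)"
  unfolding uu_def by (rule bounded_linear_imp_has_derivative[OF bounded_linear_H])

lemma smooth_on_uu: "open U \<Longrightarrow> smooth_on U (\<lambda>w. uu i j w)"
  unfolding uu_def by (rule smooth_on_bounded_linear[OF _ bounded_linear_H])

lemma uu_axis:
  "uu i j (w + h *\<^sub>R (0, axis p 1)) = (if Upair i j = p then uu i j w + h else uu i j w)"
  by (auto simp: uu_def axis_def)

lemma dense_uu: "closure {w. uu i j w \<noteq> 0} = UNIV"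
  by (rule dense_nonzero[where e="(0, axis (Upair i j) 1)" and c="\<lambda>_. 1"])
    (simp_all only: uu_axis, simp_all)

lemma open_uu: "open {w. uu i j w \<noteq> 0}"
  by (rule open_Collect_neq) (auto intro: smooth_on_continuous_on smooth_on_uu)

subsection \<open>Case O\<close>

lemma has_derivative_pd:
  assumes "smooth_on UNIV g"
  shows "(g has_derivative (\<lambda>v. \<Sum>i\<in>UNIV. pd i g x * v $ i)) (at x)"
proof -
  have d: "(g has_derivative frechet_derivative g (at x)) (at x)"
    using smooth_on_has_derivative[OF assms] by simp
  note lin = has_derivative_linear[OF d]
  have "frechet_derivative g (at x) v = (\<Sum>i\<in>UNIV. pd i g x * v $ i)" for v
  proof -
    have "frechet_derivative g (at x) v = frechet_derivative g (at x) (\<Sum>i\<in>UNIV. v $ i *\<^sub>R axis i 1)"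
      using basis_expansion[of v] by (simp add: scalar_mult_eq_scaleR)
    then show ?thesis by (simp add: linear_sum[OF lin] linear_cmul[OF lin] pd_def mult.commute)
  qed
  then have "frechet_derivative g (at x) = (\<lambda>v. \<Sum>i\<in>UNIV. pd i g x * v $ i)" by blast
  then show ?thesis using d by simp
qed

lemma smooth_on_pd: "smooth_on UNIV g \<Longrightarrow> smooth_on UNIV (pd i g)"
  using smooth_on_frechet_derivative[of UNIV g "axis i 1"] by (simp add: pd_def[abs_def])

lemma pd_commute: "smooth_on UNIV g \<Longrightarrow> pd i (pd j g) = pd j (pd i g)"
  using smooth_on_mixed_derivative_commute[of g "axis j 1" "axis i 1"]
  by (auto simp: pd_def[abs_def] fun_eq_iff)

lemma pd_eq: "(\<And>x. (g has_derivative g' x) (at x)) \<Longrightarrow> pd i g = (\<lambda>x. g' x (axis i 1))"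
  unfolding pd_def[abs_def] using frechet_derivative_at by metis

lemma jet2_lift_x:
  assumes "smooth_on UNIV g"
  shows "jet2 (\<lambda>q :: J1. g (fst q)) (\<lambda>q v. \<Sum>i\<in>UNIV. pd i g (fst q) * fst v $ i)
    (\<lambda>q v w. \<Sum>i\<in>UNIV. (\<Sum>j\<in>UNIV. pd j (pd i g) (fst q) * fst w $ j) * fst v $ i)"
proof -
  have "(\<Sum>i\<in>UNIV. (\<Sum>j\<in>UNIV. pd j (pd i g) x * w $ j) * v $ i)
      = (\<Sum>i\<in>UNIV. (\<Sum>j\<in>UNIV. pd j (pd i g) x * v $ j) * w $ i)" for x v w :: "real^4"
    unfolding sum_distrib_right
    by (subst sum.swap, intro sum.cong refl) (simp add: pd_commute[OF assms] ac_simps)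
  then have "jet2 g (\<lambda>x v. \<Sum>i\<in>UNIV. pd i g x * v $ i)
      (\<lambda>x v w. \<Sum>i\<in>UNIV. (\<Sum>j\<in>UNIV. pd j (pd i g) x * w $ j) * v $ i)"
    unfolding jet2_def
    by (intro conjI allI has_derivative_pd has_derivative_sum has_derivative_mult_left smooth_on_pd assms)
  from jet2_comp_linear[OF this bounded_linear_fst] show ?thesis by simp
qed

lemma has_hessian_lift_x:
  assumes "smooth_on UNIV g"
  shows "has_hessian (\<lambda>q. g (fst q))
    (\<lambda>q v w. \<Sum>i\<in>UNIV. (\<Sum>j\<in>UNIV. pd j (pd i g) (fst q) * fst w $ j) * fst v $ i)"
  unfolding has_hessian_def u_free_def using jet2_lift_x[OF assms] by (intro exI conjI) auto

lemma alg_O_iff: "f \<in> alg_O \<longleftrightarrow> (\<exists>g. smooth_on UNIV g \<and>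
    (\<forall>x. pd 1 (pd 1 g) x - pd 2 (pd 2 g) x - pd 3 (pd 3 g) x - pd 4 (pd 4 g) x = 0)
    \<and> f = (\<lambda>q. g (fst q)))"
  unfolding alg_O_def by (auto simp: fun_eq_iff)

lemma fst_contact_field_O:
  assumes "f \<in> alg_O" shows "fst (contact_field f q) = 0"
proof -
  obtain g where g: "smooth_on UNIV g" "f = (\<lambda>q. g (fst q))"
    using assms unfolding alg_O_iff by blast
  have "(f has_derivative (\<lambda>v. \<Sum>i\<in>UNIV. pd i g (fst q) * fst v $ i)) (at q)"
    using jet2_lift_x[OF g(1)] unfolding jet2_def g(2) by blast
  from contact_field_eq[OF this] show ?thesis by (simp add: vec_eq_iff)
qed

text \<open>For a function of x alone f''(T_i, T_j) is f_ij, since the components of T_i along the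
  u_l are not seen. The claim is then the wave equation for f.\<close>

lemma hessian_O:
  assumes "f \<in> alg_O"
  obtains B where "has_hessian f B"
    "\<And>w. hess_vec w B $ Upair 1 1 - hess_vec w B $ Upair 2 2 - hess_vec w B $ Upair 3 3
      - hess_vec w B $ Upair 4 4 = 0"
proof -
  obtain g where g: "smooth_on UNIV g" "f = (\<lambda>q. g (fst q))"
    "\<And>x. pd 1 (pd 1 g) x - pd 2 (pd 2 g) x - pd 3 (pd 3 g) x - pd 4 (pd 4 g) x = 0"
    using assms unfolding alg_O_iff by blast
  note h = has_hessian_lift_x[OF g(1)]
  show thesis
    by (rule that[OF h[folded g(2)]])
      (simp add: hess_vec_nth[OF h] g(3) tvec_def axis_def if_distrib[of "\<lambda>x. _ * x"] cong: if_cong)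
qed

text \<open>\<open>wave\<close> is half the wave operator applied to c x_i x_j + d x_k^2. One
  template thus serves constants, coordinates, mixed products and sums of two squares.\<close>

lemma quadratic_in_alg_O:
  assumes wave: "c * ((if i = 1 \<and> j = 1 then 1 else 0) - (if i = 2 \<and> j = 2 then 1 else 0)
      - (if i = 3 \<and> j = 3 then 1 else 0) - (if i = 4 \<and> j = 4 then 1 else 0))
    + d * ((if k = 1 then 1 else 0) - (if k = 2 then 1 else 0) - (if k = 3 then 1 else 0)
      - (if k = 4 then 1 else 0)) = 0"
    and f: "\<And>q. f q = a + b * coord (X i) q + c * (coord (X i) q * coord (X j) q)
      + d * (coord (X k) q * coord (X k) q)"
  shows "f \<in> alg_O"
proof -
  define g :: "real^4 \<Rightarrow> real" where
    "g x = a + b * x $ i + c * (x $ i * x $ j) + d * (x $ k * x $ k)" for x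
  have "smooth_on UNIV g"
    unfolding g_def[abs_def] by (intro smooth_on_add smooth_on_mult smooth_on_const
        smooth_on_bounded_linear bounded_linear_vec_nth open_UNIV)
  moreover have pd: "pd m g = (\<lambda>x. b * axis m 1 $ i + c * (x $ i * axis m 1 $ j + axis m 1 $ i * x $ j)
      + d * (x $ k * axis m 1 $ k + axis m 1 $ k * x $ k))" for m
    unfolding g_def[abs_def]
    by (rule pd_eq) (auto intro!: derivative_eq_intros bounded_linear_imp_has_derivative
        bounded_linear_vec_nth)
  have "pd m (pd m g) = (\<lambda>x. c * (axis m 1 $ i * axis m 1 $ j + axis m 1 $ i * axis m 1 $ j)
      + d * (axis m 1 $ k * axis m 1 $ k + axis m 1 $ k * axis m 1 $ k))" for m
    unfolding pd
    by (rule pd_eq) (auto intro!: derivative_eq_intros bounded_linear_imp_has_derivative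
        bounded_linear_vec_nth)
  then have "pd 1 (pd 1 g) x - pd 2 (pd 2 g) x - pd 3 (pd 3 g) x - pd 4 (pd 4 g) x = 0" for x
    using wave by (auto simp: axis_def algebra_simps split: if_splits)
  moreover have "f = (\<lambda>q. g (fst q))"
    using f by (auto simp: g_def coord.simps)
  ultimately show ?thesis unfolding alg_O_iff by blast
qed

lemma affine_alg_O: "(\<lambda>q. 1) \<in> alg_O" "(\<lambda>q. fst q $ i) \<in> alg_O"
  by (rule quadratic_in_alg_O[where a=1 and b=0 and c=0 and d=0]; simp)
    (rule quadratic_in_alg_O[where a=0 and b=1 and c=0 and d=0 and i=i]; simp add: coord.simps)

text \<open>By the signature (+,-,-,-), mixed products and x_1^2 + x_k^2 are solutions. They force
  a_ij = 0 off the diagonal and a_kk = -a_11, which leaves the multiples of the differential of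
  \<open>I_O\<close>.\<close>

lemma quadrics_O:
  "quadric [(1, X 1, X 2)] \<in> alg_O" "quadric [(1, X 1, X 3)] \<in> alg_O"
  "quadric [(1, X 1, X 4)] \<in> alg_O" "quadric [(1, X 2, X 3)] \<in> alg_O"
  "quadric [(1, X 2, X 4)] \<in> alg_O" "quadric [(1, X 3, X 4)] \<in> alg_O"
  "quadric [(1, X 1, X 1), (1, X 2, X 2)] \<in> alg_O"
  "quadric [(1, X 1, X 1), (1, X 3, X 3)] \<in> alg_O"
  "quadric [(1, X 1, X 1), (1, X 4, X 4)] \<in> alg_O"
  apply (rule quadratic_in_alg_O[where a=0 and b=0 and c=1 and d=0 and i=1 and j=2]; simp add: quadric_def)
  apply (rule quadratic_in_alg_O[where a=0 and b=0 and c=1 and d=0 and i=1 and j=3]; simp add: quadric_def)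
  apply (rule quadratic_in_alg_O[where a=0 and b=0 and c=1 and d=0 and i=1 and j=4]; simp add: quadric_def)
  apply (rule quadratic_in_alg_O[where a=0 and b=0 and c=1 and d=0 and i=2 and j=3]; simp add: quadric_def)
  apply (rule quadratic_in_alg_O[where a=0 and b=0 and c=1 and d=0 and i=2 and j=4]; simp add: quadric_def)
  apply (rule quadratic_in_alg_O[where a=0 and b=0 and c=1 and d=0 and i=3 and j=4]; simp add: quadric_def)
  apply (rule quadratic_in_alg_O[where a=0 and b=0 and c=1 and d=1 and i=1 and j=1 and k=2]; simp add: quadric_def)
  apply (rule quadratic_in_alg_O[where a=0 and b=0 and c=1 and d=1 and i=1 and j=1 and k=3]; simp add: quadric_def)
  apply (rule quadratic_in_alg_O[where a=0 and b=0 and c=1 and d=1 and i=1 and j=1 and k=4]; simp add: quadric_def)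
  done

text \<open>The fields of 1 and x_i, namely d_u and x_i d_u + d_{u_i}, span exactly the directions
  without x component; the u_i, which would supply the rest, do not belong to this algebra.\<close>

lemma kernel_O:
  fixes L :: "J1 \<Rightarrow> real"
  assumes lin: "linear L" and L1: "L (contact_field (\<lambda>q. 1) q) = 0"
    and Lx: "\<And>i. L (contact_field (\<lambda>q. fst q $ i) q) = 0" and v: "fst v = 0"
  shows "L v = 0"
proof -
  have u: "L (0, 1, 0) = 0" and x: "L (0, fst q $ i, axis i 1) = 0" for i
    using L1 Lx by (simp_all add: contact_field_1 contact_field_x)
  have b: "L (0, b, 0) = 0" for b
    using linear_cmul[OF lin, of b "(0, 1, 0)"] u by simp
  have "L (0, 0, axis i 1) = 0" for i
    using linear_diff[OF lin, of "(0, fst q $ i, axis i 1)" "(0, fst q $ i, 0)"] x b by simp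
  then have c: "L (0, 0, c) = 0" for c
    by (rule linear_vec_0[of "\<lambda>a. L (0, 0, a)", rotated])
      (auto intro!: linearI simp flip: linear_add[OF lin] linear_cmul[OF lin, unfolded real_scaleR_def])
  obtain b y where "v = (0, b, 0) + (0, 0, y)" using v by (cases v) auto
  then show ?thesis by (simp only: linear_add[OF lin] b c)
qed

section \<open>Invariance and completeness of x and \<open>I_O\<close>\<close>

lemma diff_invariant1_O_x: "diff_invariant1 alg_O UNIV (\<lambda>(x, u, p). x $ i)"
proof -
  have eq: "(\<lambda>(x, u, p). x $ i) = (\<lambda>q :: J1. fst q $ i)" by auto
  have "frechet_derivative (\<lambda>q :: J1. fst q $ i) (at w) = (\<lambda>q. fst q $ i)" for w
    using frechet_derivative_at[OF bounded_linear_imp_has_derivative[OF bounded_linear_x]] by metis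
  then show ?thesis
    unfolding eq diff_invariant1_def invariant_on_def lie_derivative_def
    by (auto simp: fst_contact_field_O intro: smooth_on_bounded_linear bounded_linear_x)
qed

lemma diff_invariant2_O_x: "diff_invariant2 alg_O UNIV (\<lambda>((x, u, p), H). x $ i)"
proof -
  have eq: "(\<lambda>((x, u, p), H). x $ i) = (\<lambda>w :: J2. fst (fst w) $ i)" by auto
  have bl: "bounded_linear (\<lambda>w :: J2. fst (fst w) $ i)"
    by (rule bounded_linear_compose[OF bounded_linear_x bounded_linear_fst])
  have "frechet_derivative (\<lambda>w :: J2. fst (fst w) $ i) (at w) = (\<lambda>w. fst (fst w) $ i)" for w
    using frechet_derivative_at[OF bounded_linear_imp_has_derivative[OF bl]] by metis
  moreover have "fst (prolong (contact_field f) w) = contact_field f (fst w)" if "f \<in> alg_O" for f w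
    using hessian_O[OF that] prolong_contact_field by (metis fst_conv)
  ultimately show ?thesis
    unfolding eq diff_invariant2_def invariant_on_def lie_derivative_def
    by (auto simp: fst_contact_field_O smooth_on_bounded_linear bl)
qed

lemma bounded_linear_I_O: "bounded_linear I_O"
  unfolding I_O_def[abs_def] uu_def by (intro bounded_linear_sub bounded_linear_H)

lemma diff_invariant2_I_O: "diff_invariant2 alg_O UNIV I_O"
proof -
  have "frechet_derivative I_O (at w) = I_O" for w
    using frechet_derivative_at[OF bounded_linear_imp_has_derivative[OF bounded_linear_I_O]] by metis
  moreover have "I_O (prolong (contact_field f) w) = 0" if f: "f \<in> alg_O" for f w
  proof -
    obtain B where B: "has_hessian f B" "\<And>w. hess_vec w B $ Upair 1 1 - hess_vec w B $ Upair 2 2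
        - hess_vec w B $ Upair 3 3 - hess_vec w B $ Upair 4 4 = 0"
      using hessian_O[OF f] by blast
    then show ?thesis by (simp add: prolong_contact_field I_O_def uu_def)
  qed
  ultimately show ?thesis
    unfolding diff_invariant2_def invariant_on_def lie_derivative_def
    by (auto simp: smooth_on_bounded_linear bounded_linear_I_O)
qed

lemma diff_invariant1_O_function_of_x:
  assumes "diff_invariant1 alg_O U I"
  shows "locally_function_of U I (\<lambda>(x, u, p). x)"
proof -
  have U: "open U" "smooth_on U I"
    and inv: "\<And>f w. f \<in> alg_O \<Longrightarrow> w \<in> U \<Longrightarrow> frechet_derivative I (at w) (contact_field f w) = 0"
    using assms by (auto simp: diff_invariant1_def invariant_on_def lie_derivative_def)
  have eq: "(\<lambda>(x, u, p). x) = (fst :: J1 \<Rightarrow> real^4)" by auto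
  show ?thesis
    unfolding eq
  proof (rule locally_function_of_linear[OF U bounded_linear_fst, where R="\<lambda>x. (x, 0, 0)"])
    show "frechet_derivative I (at w) v = 0" if "w \<in> U" "fst v = 0" for w v
      using kernel_O[OF has_derivative_linear[OF smooth_on_has_derivative[OF U(2) that(1)]]
          inv[OF affine_alg_O(1) that(1)] inv[OF affine_alg_O(2) that(1)] that(2)] .
  qed (auto intro!: bounded_linear_Pair bounded_linear_ident bounded_linear_zero)
qed

lemma diff_invariant2_O_function_of_I_O:
  assumes "diff_invariant2 alg_O U I"
  shows "generically_function_of U I UNIV (\<lambda>w. (fst (fst w), I_O w))"
proof -
  have U: "open U" "smooth_on U I"
    and inv: "\<And>f w. f \<in> alg_O \<Longrightarrow> w \<in> U \<Longrightarrow>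
      frechet_derivative I (at w) (prolong (contact_field f) w) = 0"
    using assms by (auto simp: diff_invariant2_def invariant_on_def lie_derivative_def)
  have "locally_function_of U I (\<lambda>w. (fst (fst w), I_O w))"
  \<comment> \<open>\<open>R\<close> stores the value of \<open>I_O\<close> in the entry u_11, which
    has coefficient 1 there.\<close>
  proof (rule locally_function_of_linear[OF U, where
        R="\<lambda>y. ((fst y, 0, 0), snd y *\<^sub>R axis (Upair 1 1) 1)"])
    fix w v assume w: "w \<in> U" and "(fst (fst v), I_O v) = 0"
    then have v: "fst (fst v) = 0" "I_O v = 0" by (auto simp: zero_prod_def)
    define L where "L = frechet_derivative I (at w)"
    have lin: "linear L"
      unfolding L_def using smooth_on_has_derivative[OF U(2) w] has_derivative_linear by blast
    have lin1: "linear (\<lambda>a. L (a, 0))" and lin2: "linear (\<lambda>a. L (0, a))"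
      by (auto intro!: linearI simp flip: linear_add[OF lin] linear_cmul[OF lin, unfolded real_scaleR_def])
    have split: "L (a, b) = L (a, 0) + L (0, b)" for a b
      using linear_add[OF lin, of "(a, 0)" "(0, b)"] by simp
    have L0: "L (contact_field f (fst w), hess_vec w B) = 0" if "f \<in> alg_O" "has_hessian f B" for f B
      using inv[OF that(1) w] unfolding prolong_contact_field[OF that(2)] L_def .
    have h0: "hess_vec w (\<lambda>q v w. 0) = 0" by (simp add: hess_vec_def sym_vec_def)
    have "has_hessian (\<lambda>q. 1) (\<lambda>q v w. 0)" "has_hessian (\<lambda>q. fst q $ i) (\<lambda>q v w. 0)" for i
      using jet2_const[of 1] jet2_linear_J1 unfolding has_hessian_def by (fastforce simp: u_free_def)+
    from this[THEN L0[rotated]] have "L (contact_field (\<lambda>q. 1) (fst w), 0) = 0"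
      "L (contact_field (\<lambda>q. fst q $ i) (fst w), 0) = 0" for i
      using affine_alg_O by (simp_all add: h0)
    \<comment> \<open>Contact fields of this algebra have no x component, so \<open>L1\<close>
      removes their \<open>J1\<close> part and leaves a condition on the Hessian alone.\<close>
    from kernel_O[OF lin1 this] have L1: "L (a, 0) = 0" if "fst a = 0" for a
      using that by blast
    have "(\<lambda>a. L (0, a)) \<in> annihilator alg_O w"
      unfolding annihilator_def mem_Collect_eq
    proof (intro conjI lin2 allI impI)
      show "L (0, hess_vec w B) = 0" if "f \<in> alg_O" "has_hessian f B" for f B
        using L0[OF that] split[of "contact_field f (fst w)" "hess_vec w B"]
          L1[OF fst_contact_field_O[OF that(1)]] by simp
    qed
    note R = quadrics_O[THEN quadric_relation, OF this refl refl, simplified]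
    have "L (0, snd v) = L (0, axis (Upair 1 1) 1) * I_O v"
      unfolding linear_uprod_expansion[OF lin2, of "snd v"] sum_uprod_4 I_O_def uu_def
      using R by (simp add: algebra_simps eq_neg_iff_add_eq_0[symmetric])
    then show "frechet_derivative I (at w) v = 0"
      using v split[of "fst v" "snd v"] L1 by (simp add: L_def)
  next
    show "bounded_linear (\<lambda>w :: J2. (fst (fst w), I_O w))"
      by (intro bounded_linear_Pair bounded_linear_I_O
          bounded_linear_compose[OF bounded_linear_fst bounded_linear_fst])
    show "bounded_linear (\<lambda>y. ((fst y, 0, 0), snd y *\<^sub>R axis (Upair 1 1) 1))"
      by (intro bounded_linear_Pair bounded_linear_zero bounded_linear_fst
          bounded_linear_compose[OF bounded_linear_scaleR_left bounded_linear_snd])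
  qed (auto simp: I_O_def uu_def axis_def)
  then show ?thesis
    unfolding generically_function_of_def using U closure_subset by (intro exI[of _ U]) auto
qed

subsection \<open>Case N\<close>

text \<open>In \<open>nabla x y\<close> the numbers x and y are constants, so its powers unfold by
  linearity of \<open>D1\<close> and \<open>D2\<close> over constant coefficients.\<close>

lemma D_linear_combination:
  assumes "smooth_on UNIV f" "smooth_on UNIV g"
  shows "D1 (\<lambda>s. a * f s + b * g s) = (\<lambda>s. a * D1 f s + b * D1 g s)"
    "D2 (\<lambda>s. a * f s + b * g s) = (\<lambda>s. a * D2 f s + b * D2 g s)"
proof -
  have "((\<lambda>s. a * f s + b * g s) has_derivative (\<lambda>v. (a * D1 f s + b * D1 g s) * fst v
      + (a * D2 f s + b * D2 g s) * snd v)) (at s)" for s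
    by (rule has_derivative_eq_rhs, (rule derivative_intros has_derivative_D assms)+)
      (simp add: algebra_simps)
  from D_unique[OF this] show "D1 (\<lambda>s. a * f s + b * g s) = (\<lambda>s. a * D1 f s + b * D1 g s)"
    "D2 (\<lambda>s. a * f s + b * g s) = (\<lambda>s. a * D2 f s + b * D2 g s)" .
qed

lemma smooth_on_linear_combination:
  "smooth_on UNIV f \<Longrightarrow> smooth_on UNIV g \<Longrightarrow> smooth_on UNIV (\<lambda>s. a * f s + b * g s)"
  by (intro smooth_on_add smooth_on_mult smooth_on_const open_UNIV)

lemma nabla_nabla:
  assumes "smooth_on UNIV A"
  shows "nabla x y (nabla x y A) s
    = x * x * D1 (D1 A) s + 2 * (x * y * D2 (D1 A) s) + y * y * D2 (D2 A) s"
  using assms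
  by (simp add: nabla_def D_linear_combination smooth_on_D D1_D2_commute) (simp add: algebra_simps)

lemma nabla_nabla_nabla:
  assumes "smooth_on UNIV A"
  shows "nabla x y (nabla x y (nabla x y A)) s = x * x * x * D1 (D1 (D1 A)) s
    + 3 * (x * x * y * D2 (D1 (D1 A)) s) + 3 * (x * y * y * D2 (D2 (D1 A)) s)
    + y * y * y * D2 (D2 (D2 A)) s"
  using assms
  by (simp add: nabla_def D_linear_combination smooth_on_linear_combination smooth_on_D
      D1_D2_commute) (simp add: algebra_simps)

text \<open>The sum of \<open>N0\<close> to \<open>N3\<close> with the powers of
  \<open>nabla\<close> expanded and everything written through \<open>coord\<close>, the shape on
  which the \<open>jet2\<close> rules act. The arguments of the parameter functions are t = x_4 and
  z = x_3, in this order.\<close>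

definition gf_N :: "(real \<times> real \<Rightarrow> real) \<Rightarrow> (real \<times> real \<Rightarrow> real) \<Rightarrow> (real \<times> real \<Rightarrow> real)
    \<Rightarrow> (real \<times> real \<Rightarrow> real) \<Rightarrow> J1 \<Rightarrow> real" where
  "gf_N A\<^sub>0 A\<^sub>1 A\<^sub>2 A\<^sub>3 = (\<lambda>q. D1 A\<^sub>0 (coord (X 4) q, coord (X 3) q) * coord (P 3) q
      - D2 A\<^sub>0 (coord (X 4) q, coord (X 3) q) * coord (P 4) q
      + (D1 (D1 A\<^sub>0) (coord (X 4) q, coord (X 3) q) * coord (X 1) q
          + D2 (D1 A\<^sub>0) (coord (X 4) q, coord (X 3) q) * coord (X 2) q) * coord (P 2) q
      - (D2 (D1 A\<^sub>0) (coord (X 4) q, coord (X 3) q) * coord (X 1) q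
          + D2 (D2 A\<^sub>0) (coord (X 4) q, coord (X 3) q) * coord (X 2) q) * coord (P 1) q
      - 1/6 * (coord (X 1) q * coord (X 1) q * coord (X 1) q
          * D1 (D1 (D1 A\<^sub>0)) (coord (X 4) q, coord (X 3) q)
        + 3 * (coord (X 1) q * coord (X 1) q * coord (X 2) q
            * D2 (D1 (D1 A\<^sub>0)) (coord (X 4) q, coord (X 3) q))
        + 3 * (coord (X 1) q * coord (X 2) q * coord (X 2) q
            * D2 (D2 (D1 A\<^sub>0)) (coord (X 4) q, coord (X 3) q))
        + coord (X 2) q * coord (X 2) q * coord (X 2) q * D2 (D2 (D2 A\<^sub>0)) (coord (X 4) q, coord
            (X 3) q))
      + (D1 A\<^sub>1 (coord (X 4) q, coord (X 3) q) * coord (P 2) q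
          - D2 A\<^sub>1 (coord (X 4) q, coord (X 3) q) * coord (P 1) q
        - 1/2 * (coord (X 1) q * coord (X 1) q * D1 (D1 A\<^sub>1) (coord (X 4) q, coord (X 3) q) + 2
            * (coord (X 1) q * coord (X 2) q * D2 (D1 A\<^sub>1) (coord (X 4) q, coord (X 3) q))
          + coord (X 2) q * coord (X 2) q * D2 (D2 A\<^sub>1) (coord (X 4) q, coord (X 3) q)))
      + (coord (X 1) q * D1 A\<^sub>2 (coord (X 4) q, coord (X 3) q) + coord (X 2) q
          * D2 A\<^sub>2 (coord (X 4) q, coord (X 3) q)) + A\<^sub>3 (coord (X 4) q, coord (X 3) q))"

lemma alg_N_iff:
  "f \<in> alg_N \<longleftrightarrow> (\<exists>A\<^sub>0 A\<^sub>1 A\<^sub>2 A\<^sub>3. smooth_on UNIV A\<^sub>0 \<and> smooth_on UNIV A\<^sub>1 \<and> smooth_on UNIV A\<^sub>2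
      \<and> smooth_on UNIV A\<^sub>3 \<and>
    f = gf_N A\<^sub>0 A\<^sub>1 A\<^sub>2 A\<^sub>3)"
proof -
  have "N0 A\<^sub>0 q + N1 A\<^sub>1 q + N2 A\<^sub>2 q + N3 A\<^sub>3 q = gf_N A\<^sub>0 A\<^sub>1 A\<^sub>2 A\<^sub>3 q"
    if "smooth_on UNIV A\<^sub>0" "smooth_on UNIV A\<^sub>1" for A\<^sub>0 A\<^sub>1 A\<^sub>2 A\<^sub>3 q
    using that
    by (cases q, simp add: gf_N_def N0_def N1_def N2_def N3_def Let_def numeral_eq_Suc
        nabla_nabla nabla_nabla_nabla)
      (simp add: nabla_def coord.simps)
  then show ?thesis
    unfolding alg_N_def mem_Collect_eq fun_eq_iff by (metis (no_types, lifting))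
qed

lemma alg_N_I:
  assumes "\<And>q. f q = gf_N A\<^sub>0 A\<^sub>1 A\<^sub>2 A\<^sub>3 q"
    and "smooth_on UNIV A\<^sub>0" "smooth_on UNIV A\<^sub>1" "smooth_on UNIV A\<^sub>2" "smooth_on UNIV A\<^sub>3"
  shows "f \<in> alg_N"
  unfolding alg_N_iff using assms by blast

text \<open>A_1 = -z, t yield u_1, u_2; A_0 = t, -z yield u_3, u_4; x and y arise as
  \<open>nabla\<close> of t and z. For linear parameters the higher powers of \<open>nabla\<close>
  vanish.\<close>

lemma heisenberg_N: "heisenberg \<subseteq> alg_N"
  apply (rule heisenbergI)
  apply (rule alg_N_I[of _ q0 q0 q0 "quad 1 0 0 0 0 0"]; simp add: gf_N_def quad_simps)
  apply (rule alg_N_I[of _ q0 q0 "quad 0 1 0 0 0 0" q0]; simp add: gf_N_def quad_simps)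
  apply (rule alg_N_I[of _ q0 q0 "quad 0 0 1 0 0 0" q0]; simp add: gf_N_def quad_simps)
  apply (rule alg_N_I[of _ q0 q0 q0 "quad 0 0 1 0 0 0"]; simp add: gf_N_def quad_simps)
  apply (rule alg_N_I[of _ q0 q0 q0 "quad 0 1 0 0 0 0"]; simp add: gf_N_def quad_simps)
  apply (rule alg_N_I[of _ q0 "quad 0 0 (-1) 0 0 0" q0 q0]; simp add: gf_N_def quad_simps)
  apply (rule alg_N_I[of _ q0 "quad 0 1 0 0 0 0" q0 q0]; simp add: gf_N_def quad_simps)
  apply (rule alg_N_I[of _ "quad 0 1 0 0 0 0" q0 q0 q0]; simp add: gf_N_def quad_simps)
  apply (rule alg_N_I[of _ "quad 0 0 (-1) 0 0 0" q0 q0 q0]; simp add: gf_N_def quad_simps)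
  done

text \<open>Multiples of t^2, tz, z^2 are inserted for A_3, A_2 and A_1 in turn; the quadratic terms
  in x, y come from the second power of \<open>nabla\<close>. Six equations give a_44 = a_34 = a_33
  = a_14 = a_23 = 0 and a_13 = -a_24, the other three express a_11, a_12, a_22 through a_24.\<close>

lemma quadrics_N:
  "quadric [(1, X 4, X 4)] \<in> alg_N"
  "quadric [(1, X 4, X 3)] \<in> alg_N"
  "quadric [(1, X 3, X 3)] \<in> alg_N"
  "quadric [(1, X 1, X 4)] \<in> alg_N"
  "quadric [(1, X 1, X 3), (1, X 2, X 4)] \<in> alg_N"
  "quadric [(1, X 2, X 3)] \<in> alg_N"
  "quadric [(1, X 4, P 2), (- 1/2, X 1, X 1)] \<in> alg_N"
  "quadric [(1, X 3, P 2), (-1, X 4, P 1), (-1, X 1, X 2)] \<in> alg_N"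
  "quadric [(-1, X 3, P 1), (- 1/2, X 2, X 2)] \<in> alg_N"
  apply (rule alg_N_I[of _ q0 q0 q0 "quad 0 0 0 1 0 0"]; simp add: gf_N_def quad_simps)
  apply (rule alg_N_I[of _ q0 q0 q0 "quad 0 0 0 0 1 0"]; simp add: gf_N_def quad_simps)
  apply (rule alg_N_I[of _ q0 q0 q0 "quad 0 0 0 0 0 1"]; simp add: gf_N_def quad_simps)
  apply (rule alg_N_I[of _ q0 q0 "quad 0 0 0 (1/2) 0 0" q0]; simp add: gf_N_def quad_simps)
  apply (rule alg_N_I[of _ q0 q0 "quad 0 0 0 0 1 0" q0]; simp add: gf_N_def quad_simps)
  apply (rule alg_N_I[of _ q0 q0 "quad 0 0 0 0 0 (1/2)" q0]; simp add: gf_N_def quad_simps)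
  apply (rule alg_N_I[of _ q0 "quad 0 0 0 (1/2) 0 0" q0 q0]; simp add: gf_N_def quad_simps)
  apply (rule alg_N_I[of _ q0 "quad 0 0 0 0 1 0" q0 q0]; simp add: gf_N_def quad_simps)
  apply (rule alg_N_I[of _ q0 "quad 0 0 0 0 0 (1/2)" q0 q0]; simp add: gf_N_def quad_simps)
  done

definition dI_N :: "J2 \<Rightarrow> (4 \<Rightarrow> 4 \<Rightarrow> real) \<Rightarrow> real" where
  "dI_N w \<eta> = \<eta> 2 4 - \<eta> 1 3 + uu 2 2 w * \<eta> 1 1 + uu 1 1 w * \<eta> 2 2 - 2 * uu 1 2 w * \<eta> 1 2"

text \<open>The \<open>nabla\<close> terms are what makes the contributions cancel. From A_1, for
  instance, \<eta>_24 receives A_1tt u_22 through u_2, while \<eta>_11 receives -A_1tt through the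
  second power of \<open>nabla\<close> and is weighted with u_22.\<close>

lemma hessian_N:
  assumes "f \<in> alg_N"
  shows "\<exists>B. has_hessian f B \<and> dI_N w (\<lambda>i k. hess_vec w B $ Upair i k) = 0"
proof (rule hessianI)
  obtain A\<^sub>0 A\<^sub>1 A\<^sub>2 A\<^sub>3 where s: "smooth_on UNIV A\<^sub>0" "smooth_on UNIV A\<^sub>1" "smooth_on UNIV A\<^sub>2"
      "smooth_on UNIV A\<^sub>3"
    and f: "f = gf_N A\<^sub>0 A\<^sub>1 A\<^sub>2 A\<^sub>3"
    using assms unfolding alg_N_iff by blast
  note s1 = s[THEN smooth_on_D(1)] s[THEN smooth_on_D(2)]
  note s2 = s1[THEN smooth_on_D(1)] s1[THEN smooth_on_D(2)]
  note s3 = s2[THEN smooth_on_D(1)] s2[THEN smooth_on_D(2)]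
  show "\<exists>f' B. jet2 f f' B \<and> u_free f' \<and> dI_N w (\<lambda>i k. B (fst w) (tvec w i) (tvec w k)) = 0"
    unfolding f gf_N_def
    apply (intro exI conjI)
    apply (rule jet2_add jet2_diff jet2_mult jet2_const jet2_coord
        s[THEN jet2_plane_coord] s1[THEN jet2_plane_coord] s2[THEN jet2_plane_coord] s3[THEN
            jet2_plane_coord])+
    apply (simp add: u_free_def)
    apply (simp add: dI_N_def s[THEN D1_D2_commute] s1[THEN D1_D2_commute] s2[THEN D1_D2_commute])
    apply (simp add: field_simps power2_eq_square)?
    done
qed

text \<open>u_24 has coefficient 1 in \<open>I_N\<close>, so it is a pivot at every point and no
  exceptional set arises.\<close>

lemma only_diff_invariant2_N: "only_diff_invariant2 alg_N UNIV I_N"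
proof (rule only_diff_invariant2I[OF heisenberg_N, where
      E="UNIV"
      and e="(0, axis (Upair 2 4) 1)" and c="\<lambda>w. 1"
      and j="\<lambda>w h. dI_N w (\<lambda>i k. h $ Upair i k)"])
  show "open UNIV"
    by (rule open_uu open_UNIV)
  show "smooth_on UNIV I_N"
    unfolding I_N_def[abs_def]
    by (intro smooth_on_diff smooth_on_add smooth_on_mult smooth_on_power smooth_on_divide
        smooth_on_uu)
      (auto intro: open_uu)
  show "(I_N has_derivative (\<lambda>v. dI_N w (\<lambda>i k. snd v $ Upair i k))) (at w)" if "w \<in> UNIV" for w
    unfolding I_N_def[abs_def] dI_N_def
    by (rule has_derivative_eq_rhs, (rule derivative_intros has_derivative_uu)+)
      (use that in \<open>auto simp: fun_eq_iff field_simps power2_eq_square\<close>)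
  show "\<exists>B. has_hessian f B \<and> dI_N w (\<lambda>i k. hess_vec w B $ Upair i k) = 0"
    if f: "f \<in> alg_N" for f w
  proof -
    obtain B where "has_hessian f B" "dI_N w (\<lambda>i k. hess_vec w B $ Upair i k) = 0"
      using hessian_N[OF f, of w] by blast
    then show ?thesis by (intro exI[of _ B]) simp
  qed
  show "open UNIV" "closure UNIV = UNIV"
    by (intro open_Int dense_Int open_uu dense_uu open_UNIV closure_UNIV)+
  show "smooth_on UNIV (\<lambda>w. 1)"
    by (intro smooth_on_divide smooth_on_diff smooth_on_mult smooth_on_uminus smooth_on_uu
        smooth_on_const open_Int
        open_uu open_UNIV)
  show "I_N (w + h *\<^sub>R (0, axis (Upair 2 4) 1)) = I_N w + h * 1" for w h
    unfolding I_N_def uu_axis by (simp add: add_divide_distrib diff_divide_distrib algebra_simps)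
next
  fix w and h :: "real^(4 uprod)" and L :: "real^(4 uprod) \<Rightarrow> real"
  assume w: "w \<in> UNIV"
    and L: "L \<in> annihilator alg_N w"
    and h: "dI_N w (\<lambda>i k. h $ Upair i k) = 0"
  define a where "a i j = L (axis (Upair i j) 1)" for i j
  note R = quadrics_N[THEN quadric_relation, OF L refl a_def, simplified]
  have zero: "a 4 4 = 0" "a 3 4 = 0" "a 3 3 = 0" "a 1 4 = 0" "a 2 3 = 0"
    using R by simp_all
  note R = R[unfolded zero, simplified]
  from zero have "L h = a 1 1 * h $ Upair 1 1 + a 1 2 * h $ Upair 1 2 + a 1 3 * h $ Upair 1 3
      + a 2 2 * h $ Upair 2 2 + a 2 4 * h $ Upair 2 4"
    using L by (simp add: annihilator_def linear_uprod_expansion[of L h] sum_uprod_4 a_def)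
  moreover define l where "l = a 2 4"
  have a13: "a 1 3 = - a 2 4"
    using R(5) by linarith
  have "a 2 4 = l" "a 1 3 = - l" "a 1 1 = l * uu 2 2 w" "a 2 2 = l * uu 1 1 w"
    "a 1 2 = - 2 * l * uu 1 2 w"
    using R(7-9) by (simp_all add: l_def a13 algebra_simps)
  ultimately have "L h = l * dI_N w (\<lambda>i k. h $ Upair i k)"
    by (simp only: dI_N_def) (simp add: algebra_simps power2_eq_square)
  then show "L h = 0" using h w by simp
qed auto

subsection \<open>Case D\<close>

definition gf_D :: "(real \<times> real \<Rightarrow> real) \<Rightarrow> (real \<times> real \<Rightarrow> real) \<Rightarrow> (real \<times> real \<Rightarrow> real)
    \<Rightarrow> (real \<times> real \<Rightarrow> real) \<Rightarrow> J1 \<Rightarrow> real" where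
  "gf_D A\<^sub>0 A\<^sub>1 B\<^sub>0 B\<^sub>1 = (\<lambda>q. D1 A\<^sub>0 (coord (X 1) q, coord (X 2) q) * coord (P 2) q
      - D2 A\<^sub>0 (coord (X 1) q, coord (X 2) q) * coord (P 1) q + A\<^sub>1 (coord (X 1) q, coord (X 2) q)
      + (D1 B\<^sub>0 (coord (X 4) q, coord (X 3) q) * coord (P 3) q
          - D2 B\<^sub>0 (coord (X 4) q, coord (X 3) q) * coord (P 4) q)
          + B\<^sub>1 (coord (X 4) q, coord (X 3) q))"

lemma alg_D_iff:
  "f \<in> alg_D \<longleftrightarrow> (\<exists>A\<^sub>0 A\<^sub>1 B\<^sub>0 B\<^sub>1. smooth_on UNIV A\<^sub>0 \<and> smooth_on UNIV A\<^sub>1 \<and> smooth_on UNIV B\<^sub>0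
      \<and> smooth_on UNIV B\<^sub>1 \<and>
    f = gf_D A\<^sub>0 A\<^sub>1 B\<^sub>0 B\<^sub>1)"
  unfolding alg_D_def mem_Collect_eq fun_eq_iff gf_D_def
  by (simp add: Let_def coord.simps power2_eq_square mult.assoc) blast

lemma alg_D_I:
  assumes "\<And>q. f q = gf_D A\<^sub>0 A\<^sub>1 B\<^sub>0 B\<^sub>1 q"
    and "smooth_on UNIV A\<^sub>0" "smooth_on UNIV A\<^sub>1" "smooth_on UNIV B\<^sub>0" "smooth_on UNIV B\<^sub>1"
  shows "f \<in> alg_D"
  unfolding alg_D_iff using assms by blast

lemma heisenberg_D: "heisenberg \<subseteq> alg_D"
  apply (rule heisenbergI)
  apply (rule alg_D_I[of _ q0 "quad 1 0 0 0 0 0" q0 q0]; simp add: gf_D_def quad_simps)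
  apply (rule alg_D_I[of _ q0 "quad 0 1 0 0 0 0" q0 q0]; simp add: gf_D_def quad_simps)
  apply (rule alg_D_I[of _ q0 "quad 0 0 1 0 0 0" q0 q0]; simp add: gf_D_def quad_simps)
  apply (rule alg_D_I[of _ q0 q0 q0 "quad 0 0 1 0 0 0"]; simp add: gf_D_def quad_simps)
  apply (rule alg_D_I[of _ q0 q0 q0 "quad 0 1 0 0 0 0"]; simp add: gf_D_def quad_simps)
  apply (rule alg_D_I[of _ "quad 0 0 (-1) 0 0 0" q0 q0 q0]; simp add: gf_D_def quad_simps)
  apply (rule alg_D_I[of _ "quad 0 1 0 0 0 0" q0 q0 q0]; simp add: gf_D_def quad_simps)
  apply (rule alg_D_I[of _ q0 q0 "quad 0 1 0 0 0 0" q0]; simp add: gf_D_def quad_simps)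
  apply (rule alg_D_I[of _ q0 q0 "quad 0 0 (-1) 0 0 0" q0]; simp add: gf_D_def quad_simps)
  done

text \<open>The products of x, y and of z, t remove the a_ij with both indices in {1,2} or both in
  {3,4}. The other six quadrics form sl_2 \<times> sl_2 acting on the 2 by 2 block of u_ij with i in
  {1,2} and j in {3,4}, whose determinant is -\<open>I_D\<close>.\<close>

lemma quadrics_D:
  "quadric [(1, X 1, X 1)] \<in> alg_D"
  "quadric [(1, X 1, X 2)] \<in> alg_D"
  "quadric [(1, X 2, X 2)] \<in> alg_D"
  "quadric [(1, X 4, X 4)] \<in> alg_D"
  "quadric [(1, X 4, X 3)] \<in> alg_D"
  "quadric [(1, X 3, X 3)] \<in> alg_D"
  "quadric [(1, X 1, P 2)] \<in> alg_D"
  "quadric [(1, X 2, P 2), (-1, X 1, P 1)] \<in> alg_D"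
  "quadric [(-1, X 2, P 1)] \<in> alg_D"
  "quadric [(1, X 4, P 3)] \<in> alg_D"
  "quadric [(1, X 3, P 3), (-1, X 4, P 4)] \<in> alg_D"
  "quadric [(-1, X 3, P 4)] \<in> alg_D"
  apply (rule alg_D_I[of _ q0 "quad 0 0 0 1 0 0" q0 q0]; simp add: gf_D_def quad_simps)
  apply (rule alg_D_I[of _ q0 "quad 0 0 0 0 1 0" q0 q0]; simp add: gf_D_def quad_simps)
  apply (rule alg_D_I[of _ q0 "quad 0 0 0 0 0 1" q0 q0]; simp add: gf_D_def quad_simps)
  apply (rule alg_D_I[of _ q0 q0 q0 "quad 0 0 0 1 0 0"]; simp add: gf_D_def quad_simps)
  apply (rule alg_D_I[of _ q0 q0 q0 "quad 0 0 0 0 1 0"]; simp add: gf_D_def quad_simps)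
  apply (rule alg_D_I[of _ q0 q0 q0 "quad 0 0 0 0 0 1"]; simp add: gf_D_def quad_simps)
  apply (rule alg_D_I[of _ "quad 0 0 0 (1/2) 0 0" q0 q0 q0]; simp add: gf_D_def quad_simps)
  apply (rule alg_D_I[of _ "quad 0 0 0 0 1 0" q0 q0 q0]; simp add: gf_D_def quad_simps)
  apply (rule alg_D_I[of _ "quad 0 0 0 0 0 (1/2)" q0 q0 q0]; simp add: gf_D_def quad_simps)
  apply (rule alg_D_I[of _ q0 q0 "quad 0 0 0 (1/2) 0 0" q0]; simp add: gf_D_def quad_simps)
  apply (rule alg_D_I[of _ q0 q0 "quad 0 0 0 0 1 0" q0]; simp add: gf_D_def quad_simps)
  apply (rule alg_D_I[of _ q0 q0 "quad 0 0 0 0 0 (1/2)" q0]; simp add: gf_D_def quad_simps)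
  done

definition dI_D :: "J2 \<Rightarrow> (4 \<Rightarrow> 4 \<Rightarrow> real) \<Rightarrow> real" where
  "dI_D w \<eta> = uu 2 3 w * \<eta> 1 4 + uu 1 4 w * \<eta> 2 3 - uu 2 4 w * \<eta> 1 3 - uu 1 3 w * \<eta> 2 4"

text \<open>On the block u_13, u_14, u_23, u_24 the parameters A_0 and B_0 act through trace-free
  matrices of second derivatives, and A_1, B_1 do not reach it. Its determinant is therefore
  stationary.\<close>

lemma hessian_D:
  assumes "f \<in> alg_D"
  shows "\<exists>B. has_hessian f B \<and> dI_D w (\<lambda>i k. hess_vec w B $ Upair i k) = 0"
proof (rule hessianI)
  obtain A\<^sub>0 A\<^sub>1 B\<^sub>0 B\<^sub>1 where s: "smooth_on UNIV A\<^sub>0" "smooth_on UNIV A\<^sub>1" "smooth_on UNIV B\<^sub>0"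
      "smooth_on UNIV B\<^sub>1"
    and f: "f = gf_D A\<^sub>0 A\<^sub>1 B\<^sub>0 B\<^sub>1"
    using assms unfolding alg_D_iff by blast
  note s1 = s[THEN smooth_on_D(1)] s[THEN smooth_on_D(2)]
  show "\<exists>f' B. jet2 f f' B \<and> u_free f' \<and> dI_D w (\<lambda>i k. B (fst w) (tvec w i) (tvec w k)) = 0"
    unfolding f gf_D_def
    apply (intro exI conjI)
    apply (rule jet2_add jet2_diff jet2_mult jet2_const jet2_coord
        s[THEN jet2_plane_coord] s1[THEN jet2_plane_coord])+
    apply (simp add: u_free_def)
    apply (simp add: dI_D_def s[THEN D1_D2_commute])
    apply (simp add: field_simps power2_eq_square)?
    done
qed

text \<open>u_23 serves twice: it is the coefficient of the pivot u_14, and division by it expresses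
  a_13, a_23, a_24 through a_14.\<close>

lemma only_diff_invariant2_D: "only_diff_invariant2 alg_D UNIV I_D"
proof (rule only_diff_invariant2I[OF heisenberg_D, where
      E="{w. uu 2 3 w \<noteq> 0}"
      and e="(0, axis (Upair 1 4) 1)" and c="\<lambda>w. uu 2 3 w"
      and j="\<lambda>w h. dI_D w (\<lambda>i k. h $ Upair i k)"])
  show "open UNIV"
    by (rule open_uu open_UNIV)
  show "smooth_on UNIV I_D"
    unfolding I_D_def[abs_def]
    by (intro smooth_on_diff smooth_on_add smooth_on_mult smooth_on_power smooth_on_divide
        smooth_on_uu)
      (auto intro: open_uu)
  show "(I_D has_derivative (\<lambda>v. dI_D w (\<lambda>i k. snd v $ Upair i k))) (at w)" if "w \<in> UNIV" for w
    unfolding I_D_def[abs_def] dI_D_def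
    by (rule has_derivative_eq_rhs, (rule derivative_intros has_derivative_uu)+)
      (use that in \<open>auto simp: fun_eq_iff field_simps power2_eq_square\<close>)
  show "\<exists>B. has_hessian f B \<and> dI_D w (\<lambda>i k. hess_vec w B $ Upair i k) = 0"
    if f: "f \<in> alg_D" for f w
  proof -
    obtain B where "has_hessian f B" "dI_D w (\<lambda>i k. hess_vec w B $ Upair i k) = 0"
      using hessian_D[OF f, of w] by blast
    then show ?thesis by (intro exI[of _ B]) simp
  qed
  show "open {w. uu 2 3 w \<noteq> 0}" "closure {w. uu 2 3 w \<noteq> 0} = UNIV"
    by (intro open_Int dense_Int open_uu dense_uu open_UNIV closure_UNIV)+
  show "smooth_on {w. uu 2 3 w \<noteq> 0} (\<lambda>w. uu 2 3 w)"
    by (intro smooth_on_divide smooth_on_diff smooth_on_mult smooth_on_uminus smooth_on_uu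
        smooth_on_const open_Int
        open_uu open_UNIV)
  show "I_D (w + h *\<^sub>R (0, axis (Upair 1 4) 1)) = I_D w + h * (uu 2 3 w)" for w h
    unfolding I_D_def uu_axis by (simp add: add_divide_distrib diff_divide_distrib algebra_simps)
next
  fix w and h :: "real^(4 uprod)" and L :: "real^(4 uprod) \<Rightarrow> real"
  assume w: "w \<in> {w. uu 2 3 w \<noteq> 0}"
    and L: "L \<in> annihilator alg_D w"
    and h: "dI_D w (\<lambda>i k. h $ Upair i k) = 0"
  define a where "a i j = L (axis (Upair i j) 1)" for i j
  note R = quadrics_D[THEN quadric_relation, OF L refl a_def, simplified]
  have zero: "a 1 1 = 0" "a 1 2 = 0" "a 2 2 = 0" "a 3 3 = 0" "a 3 4 = 0" "a 4 4 = 0"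
    using R by simp_all
  note R = R[unfolded zero, simplified]
  from zero have "L h = a 1 3 * h $ Upair 1 3 + a 1 4 * h $ Upair 1 4 + a 2 3 * h $ Upair 2 3
      + a 2 4 * h $ Upair 2 4"
    using L by (simp add: annihilator_def linear_uprod_expansion[of L h] sum_uprod_4 a_def)
  moreover define l where "l = a 1 4 / uu 2 3 w"
  have "a 1 4 = l * uu 2 3 w" "a 1 3 = - l * uu 2 4 w" "a 2 4 = - l * uu 1 3 w" "a 2 3 = l
      * uu 1 4 w"
    using R w by (simp_all add: l_def field_simps power2_eq_square)
  ultimately have "L h = l * dI_D w (\<lambda>i k. h $ Upair i k)"
    by (simp only: dI_D_def) (simp add: algebra_simps power2_eq_square)
  then show "L h = 0" using h w by simp
qed auto

subsection \<open>Case III\<close>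

definition gf_III :: "(real \<times> real \<Rightarrow> real) \<Rightarrow> (real \<times> real \<Rightarrow> real) \<Rightarrow> (real \<times> real \<Rightarrow> real)
    \<Rightarrow> (real \<times> real \<Rightarrow> real) \<Rightarrow> J1 \<Rightarrow> real" where
  "gf_III A\<^sub>0 A\<^sub>1 A\<^sub>2 B\<^sub>0 = (\<lambda>q. D2 A\<^sub>0 (coord (X 1) q, coord (X 2) q) * coord (P 1) q
      - D1 A\<^sub>0 (coord (X 1) q, coord (X 2) q) * coord (P 2) q
      + 1/2 * (D2 (D2 A\<^sub>0) (coord (X 1) q, coord (X 2) q) * (coord (X 3) q * coord (X 3) q)
        - 2 * (D2 (D1 A\<^sub>0) (coord (X 1) q, coord (X 2) q) * (coord (X 3) q * coord (P 3) q))
            + D1 (D1 A\<^sub>0) (coord (X 1) q, coord (X 2) q) * (coord (P 3) q * coord (P 3) q))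
      + (D2 A\<^sub>1 (coord (X 1) q, coord (X 2) q) * coord (X 3) q
          - D1 A\<^sub>1 (coord (X 1) q, coord (X 2) q) * coord (P 3) q)
          + A\<^sub>2 (coord (X 1) q, coord (X 2) q) + B\<^sub>0 (coord (X 4) q, coord (P 4) q))"

lemma alg_III_iff:
  "f \<in> alg_III \<longleftrightarrow> (\<exists>A\<^sub>0 A\<^sub>1 A\<^sub>2 B\<^sub>0. smooth_on UNIV A\<^sub>0 \<and> smooth_on UNIV A\<^sub>1 \<and> smooth_on UNIV A\<^sub>2
      \<and> smooth_on UNIV B\<^sub>0 \<and>
    f = gf_III A\<^sub>0 A\<^sub>1 A\<^sub>2 B\<^sub>0)"
  unfolding alg_III_def mem_Collect_eq fun_eq_iff gf_III_def
  by (simp add: Let_def coord.simps power2_eq_square mult.assoc) blast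

lemma alg_III_I:
  assumes "\<And>q. f q = gf_III A\<^sub>0 A\<^sub>1 A\<^sub>2 B\<^sub>0 q"
    and "smooth_on UNIV A\<^sub>0" "smooth_on UNIV A\<^sub>1" "smooth_on UNIV A\<^sub>2" "smooth_on UNIV B\<^sub>0"
  shows "f \<in> alg_III"
  unfolding alg_III_iff using assms by blast

lemma heisenberg_III: "heisenberg \<subseteq> alg_III"
  apply (rule heisenbergI)
  apply (rule alg_III_I[of _ q0 q0 "quad 1 0 0 0 0 0" q0]; simp add: gf_III_def quad_simps)
  apply (rule alg_III_I[of _ q0 q0 "quad 0 1 0 0 0 0" q0]; simp add: gf_III_def quad_simps)
  apply (rule alg_III_I[of _ q0 q0 "quad 0 0 1 0 0 0" q0]; simp add: gf_III_def quad_simps)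
  apply (rule alg_III_I[of _ q0 "quad 0 0 1 0 0 0" q0 q0]; simp add: gf_III_def quad_simps)
  apply (rule alg_III_I[of _ q0 q0 q0 "quad 0 1 0 0 0 0"]; simp add: gf_III_def quad_simps)
  apply (rule alg_III_I[of _ "quad 0 0 1 0 0 0" q0 q0 q0]; simp add: gf_III_def quad_simps)
  apply (rule alg_III_I[of _ "quad 0 (-1) 0 0 0 0" q0 q0 q0]; simp add: gf_III_def quad_simps)
  apply (rule alg_III_I[of _ q0 "quad 0 (-1) 0 0 0 0" q0 q0]; simp add: gf_III_def quad_simps)
  apply (rule alg_III_I[of _ q0 q0 q0 "quad 0 0 1 0 0 0"]; simp add: gf_III_def quad_simps)
  done

text \<open>A_2 and A_1 run through the quadratic monomials in x, y up to scaling. A_0 = y^2/2 gives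
  y u_x + z^2/2, the summand z^2/2 stemming from A_0yy; B_0 gives t^2 and t u_t.\<close>

lemma quadrics_III:
  "quadric [(1, X 1, X 1)] \<in> alg_III"
  "quadric [(1, X 1, X 2)] \<in> alg_III"
  "quadric [(1, X 2, X 2)] \<in> alg_III"
  "quadric [(-1, X 1, P 3)] \<in> alg_III"
  "quadric [(1, X 1, X 3), (-1, X 2, P 3)] \<in> alg_III"
  "quadric [(1, X 2, X 3)] \<in> alg_III"
  "quadric [(1, X 2, P 1), (1/2, X 3, X 3)] \<in> alg_III"
  "quadric [(1, X 4, X 4)] \<in> alg_III"
  "quadric [(1, X 4, P 4)] \<in> alg_III"
  apply (rule alg_III_I[of _ q0 q0 "quad 0 0 0 1 0 0" q0]; simp add: gf_III_def quad_simps)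
  apply (rule alg_III_I[of _ q0 q0 "quad 0 0 0 0 1 0" q0]; simp add: gf_III_def quad_simps)
  apply (rule alg_III_I[of _ q0 q0 "quad 0 0 0 0 0 1" q0]; simp add: gf_III_def quad_simps)
  apply (rule alg_III_I[of _ q0 "quad 0 0 0 (1/2) 0 0" q0 q0]; simp add: gf_III_def quad_simps)
  apply (rule alg_III_I[of _ q0 "quad 0 0 0 0 1 0" q0 q0]; simp add: gf_III_def quad_simps)
  apply (rule alg_III_I[of _ q0 "quad 0 0 0 0 0 (1/2)" q0 q0]; simp add: gf_III_def quad_simps)
  apply (rule alg_III_I[of _ "quad 0 0 0 0 0 (1/2)" q0 q0 q0]; simp add: gf_III_def quad_simps)
  apply (rule alg_III_I[of _ q0 q0 q0 "quad 0 0 0 1 0 0"]; simp add: gf_III_def quad_simps)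
  apply (rule alg_III_I[of _ q0 q0 q0 "quad 0 0 0 0 1 0"]; simp add: gf_III_def quad_simps)
  done

text \<open>The differential of the invariant times the square of its denominator; likewise in cases II
  and I.\<close>

definition dI_III :: "J2 \<Rightarrow> (4 \<Rightarrow> 4 \<Rightarrow> real) \<Rightarrow> real" where
  "dI_III w \<eta> = uu 3 4 w * \<eta> 2 4 - uu 3 3 w * uu 3 4 w * \<eta> 1 4 - uu 1 4 w * uu 3 4 w * \<eta> 3 3
    + (uu 3 4 w)^2 * \<eta> 1 3 - (uu 2 4 w - uu 1 4 w * uu 3 3 w) * \<eta> 3 4"

text \<open>B_0(t, u_t) multiplies u_14, u_24, u_34 by a common infinitesimal factor, for which
  \<open>I_III\<close> has degree zero. It also adds a multiple of u_i4 u_j4 to the other u_ij, and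
  the changes of u_33 and u_13 cancel in -u_14 u_33 + u_13 u_34.\<close>

lemma hessian_III:
  assumes "f \<in> alg_III"
  shows "\<exists>B. has_hessian f B \<and> dI_III w (\<lambda>i k. hess_vec w B $ Upair i k) = 0"
proof (rule hessianI)
  obtain A\<^sub>0 A\<^sub>1 A\<^sub>2 B\<^sub>0 where s: "smooth_on UNIV A\<^sub>0" "smooth_on UNIV A\<^sub>1" "smooth_on UNIV A\<^sub>2"
      "smooth_on UNIV B\<^sub>0"
    and f: "f = gf_III A\<^sub>0 A\<^sub>1 A\<^sub>2 B\<^sub>0"
    using assms unfolding alg_III_iff by blast
  note s1 = s[THEN smooth_on_D(1)] s[THEN smooth_on_D(2)]
  note s2 = s1[THEN smooth_on_D(1)] s1[THEN smooth_on_D(2)]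
  show "\<exists>f' B. jet2 f f' B \<and> u_free f' \<and> dI_III w (\<lambda>i k. B (fst w) (tvec w i) (tvec w k)) = 0"
    unfolding f gf_III_def
    apply (intro exI conjI)
    apply (rule jet2_add jet2_diff jet2_mult jet2_const jet2_coord
        s[THEN jet2_plane_coord] s1[THEN jet2_plane_coord] s2[THEN jet2_plane_coord])+
    apply (simp add: u_free_def)
    apply (simp add: dI_III_def s[THEN D1_D2_commute] s1[THEN D1_D2_commute])
    apply (simp add: field_simps power2_eq_square)?
    done
qed

lemma only_diff_invariant2_III: "only_diff_invariant2 alg_III {w. uu 3 4 w \<noteq> 0} I_III"
proof (rule only_diff_invariant2I[OF heisenberg_III, where
      E="{w. uu 3 4 w \<noteq> 0}"
      and e="(0, axis (Upair 2 4) 1)" and c="\<lambda>w. 1 / uu 3 4 w"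
      and j="\<lambda>w h. dI_III w (\<lambda>i k. h $ Upair i k) / (uu 3 4 w)^2"])
  show "open {w. uu 3 4 w \<noteq> 0}"
    by (rule open_uu open_UNIV)
  show "smooth_on {w. uu 3 4 w \<noteq> 0} I_III"
    unfolding I_III_def[abs_def]
    by (intro smooth_on_diff smooth_on_add smooth_on_mult smooth_on_power smooth_on_divide
        smooth_on_uu)
      (auto intro: open_uu)
  show "(I_III has_derivative (\<lambda>v. dI_III w (\<lambda>i k. snd v $ Upair i k) / (uu 3 4 w)^2)) (at w)" if
      "w \<in> {w. uu 3 4 w \<noteq> 0}" for w
    unfolding I_III_def[abs_def] dI_III_def
    by (rule has_derivative_eq_rhs, (rule derivative_intros has_derivative_uu)+)
      (use that in \<open>auto simp: fun_eq_iff field_simps power2_eq_square\<close>)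
  show "\<exists>B. has_hessian f B \<and> dI_III w (\<lambda>i k. hess_vec w B $ Upair i k) / (uu 3 4 w)^2 = 0"
    if f: "f \<in> alg_III" for f w
  proof -
    obtain B where "has_hessian f B" "dI_III w (\<lambda>i k. hess_vec w B $ Upair i k) = 0"
      using hessian_III[OF f, of w] by blast
    then show ?thesis by (intro exI[of _ B]) simp
  qed
  show "open {w. uu 3 4 w \<noteq> 0}" "closure {w. uu 3 4 w \<noteq> 0} = UNIV"
    by (intro open_Int dense_Int open_uu dense_uu open_UNIV closure_UNIV)+
  show "smooth_on {w. uu 3 4 w \<noteq> 0} (\<lambda>w. 1 / uu 3 4 w)"
    by (intro smooth_on_divide smooth_on_diff smooth_on_mult smooth_on_uminus smooth_on_uu
        smooth_on_const open_Int
        open_uu open_UNIV) auto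
  \<comment> \<open>Where u_34 = 0 both quotients are 0 by the convention for division, so the
    identity holds for all \<open>w\<close>.\<close>
  show "I_III (w + h *\<^sub>R (0, axis (Upair 2 4) 1)) = I_III w + h * (1 / uu 3 4 w)" for w h
    unfolding I_III_def uu_axis by (simp add: add_divide_distrib diff_divide_distrib
        algebra_simps)
next
  fix w and h :: "real^(4 uprod)" and L :: "real^(4 uprod) \<Rightarrow> real"
  assume w: "w \<in> {w. uu 3 4 w \<noteq> 0}"
    and L: "L \<in> annihilator alg_III w"
    and h: "dI_III w (\<lambda>i k. h $ Upair i k) / (uu 3 4 w)^2 = 0"
  define a where "a i j = L (axis (Upair i j) 1)" for i j
  note R = quadrics_III[THEN quadric_relation, OF L refl a_def, simplified]
  have zero: "a 1 1 = 0" "a 1 2 = 0" "a 2 2 = 0" "a 2 3 = 0" "a 4 4 = 0"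
    using R by simp_all
  note R = R[unfolded zero, simplified]
  from zero have "L h = a 1 3 * h $ Upair 1 3 + a 1 4 * h $ Upair 1 4 + a 2 4 * h $ Upair 2 4
      + a 3 3 * h $ Upair 3 3 + a 3 4 * h $ Upair 3 4"
    using L by (simp add: annihilator_def linear_uprod_expansion[of L h] sum_uprod_4 a_def)
  \<comment> \<open>The multiplier is read off at \<eta>_24, whose coefficient in
    \<open>dI_III\<close> is u_34.\<close>
  moreover define l where "l = a 2 4 / uu 3 4 w"
  have nz: "uu 3 4 w \<noteq> 0" using w by simp
  have l: "a 2 4 = l * uu 3 4 w" using w by (simp add: l_def)
  \<comment> \<open>In turn: x z - y u_z determines a_13, y u_x + z^2/2 determines a_33, x u_z
    determines a_14, and t u_t determines a_34.\<close>
  have a13: "a 1 3 = l * (uu 3 4 w)^2" using R(5) l by (simp add: power2_eq_square)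
  have a33: "a 3 3 = - l * uu 1 4 w * uu 3 4 w" using R(7) l by (simp add: algebra_simps)
  have "a 1 4 * uu 3 4 w = (- l * uu 3 3 w * uu 3 4 w) * uu 3 4 w"
    using R(4,5) l by (simp add: algebra_simps)
  then have a14: "a 1 4 = - l * uu 3 3 w * uu 3 4 w" by (simp only: mult_right_cancel nz
      not_False_eq_True)
  have "a 3 4 * uu 3 4 w = (- l * (uu 2 4 w - uu 1 4 w * uu 3 3 w)) * uu 3 4 w"
    using R(9) unfolding l a14 by (simp add: algebra_simps)
  then have "a 3 4 = - l * (uu 2 4 w - uu 1 4 w * uu 3 3 w)" by (simp only: mult_right_cancel nz
      not_False_eq_True)
  note this l a13 a33 a14
  ultimately have "L h = l * dI_III w (\<lambda>i k. h $ Upair i k)"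
    by (simp only: dI_III_def) (simp add: algebra_simps power2_eq_square)
  then show "L h = 0" using h w by simp
qed auto

subsection \<open>Case II\<close>

definition gf_II :: "(real \<times> real \<Rightarrow> real) \<Rightarrow> (real \<times> real \<Rightarrow> real) \<Rightarrow> (real \<times> real \<Rightarrow> real)
    \<Rightarrow> (real \<times> real \<Rightarrow> real) \<Rightarrow> J1 \<Rightarrow> real" where
  "gf_II A\<^sub>0 A\<^sub>1 B\<^sub>0 C\<^sub>0 = (\<lambda>q. D2 A\<^sub>0 (coord (X 2) q, coord (X 3) q) * coord (P 2) q
      - D1 A\<^sub>0 (coord (X 2) q, coord (X 3) q) * coord (P 3) q + A\<^sub>1 (coord (X 2) q, coord (X 3) q)
      + B\<^sub>0 (coord (X 1) q, coord (P 1) q) + C\<^sub>0 (coord (X 4) q, coord (P 4) q))"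

lemma alg_II_iff:
  "f \<in> alg_II \<longleftrightarrow> (\<exists>A\<^sub>0 A\<^sub>1 B\<^sub>0 C\<^sub>0. smooth_on UNIV A\<^sub>0 \<and> smooth_on UNIV A\<^sub>1 \<and> smooth_on UNIV B\<^sub>0
      \<and> smooth_on UNIV C\<^sub>0 \<and>
    f = gf_II A\<^sub>0 A\<^sub>1 B\<^sub>0 C\<^sub>0)"
  unfolding alg_II_def mem_Collect_eq fun_eq_iff gf_II_def
  by (simp add: Let_def coord.simps power2_eq_square mult.assoc) blast

lemma alg_II_I:
  assumes "\<And>q. f q = gf_II A\<^sub>0 A\<^sub>1 B\<^sub>0 C\<^sub>0 q"
    and "smooth_on UNIV A\<^sub>0" "smooth_on UNIV A\<^sub>1" "smooth_on UNIV B\<^sub>0" "smooth_on UNIV C\<^sub>0"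
  shows "f \<in> alg_II"
  unfolding alg_II_iff using assms by blast

lemma heisenberg_II: "heisenberg \<subseteq> alg_II"
  apply (rule heisenbergI)
  apply (rule alg_II_I[of _ q0 "quad 1 0 0 0 0 0" q0 q0]; simp add: gf_II_def quad_simps)
  apply (rule alg_II_I[of _ q0 q0 "quad 0 1 0 0 0 0" q0]; simp add: gf_II_def quad_simps)
  apply (rule alg_II_I[of _ q0 "quad 0 1 0 0 0 0" q0 q0]; simp add: gf_II_def quad_simps)
  apply (rule alg_II_I[of _ q0 "quad 0 0 1 0 0 0" q0 q0]; simp add: gf_II_def quad_simps)
  apply (rule alg_II_I[of _ q0 q0 q0 "quad 0 1 0 0 0 0"]; simp add: gf_II_def quad_simps)
  apply (rule alg_II_I[of _ q0 q0 "quad 0 0 1 0 0 0" q0]; simp add: gf_II_def quad_simps)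
  apply (rule alg_II_I[of _ "quad 0 0 1 0 0 0" q0 q0 q0]; simp add: gf_II_def quad_simps)
  apply (rule alg_II_I[of _ "quad 0 (-1) 0 0 0 0" q0 q0 q0]; simp add: gf_II_def quad_simps)
  apply (rule alg_II_I[of _ q0 q0 q0 "quad 0 0 1 0 0 0"]; simp add: gf_II_def quad_simps)
  done

text \<open>A_1 removes a_22, a_23, a_33, the squares of x and t remove a_11 and a_44; A_0 gives
  sl_2 on (y, z), and x u_x, t u_t are scalings.\<close>

lemma quadrics_II:
  "quadric [(1, X 2, X 2)] \<in> alg_II"
  "quadric [(1, X 2, X 3)] \<in> alg_II"
  "quadric [(1, X 3, X 3)] \<in> alg_II"
  "quadric [(-1, X 2, P 3)] \<in> alg_II"
  "quadric [(1, X 2, P 2), (-1, X 3, P 3)] \<in> alg_II"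
  "quadric [(1, X 3, P 2)] \<in> alg_II"
  "quadric [(1, X 1, X 1)] \<in> alg_II"
  "quadric [(1, X 1, P 1)] \<in> alg_II"
  "quadric [(1, X 4, X 4)] \<in> alg_II"
  "quadric [(1, X 4, P 4)] \<in> alg_II"
  apply (rule alg_II_I[of _ q0 "quad 0 0 0 1 0 0" q0 q0]; simp add: gf_II_def quad_simps)
  apply (rule alg_II_I[of _ q0 "quad 0 0 0 0 1 0" q0 q0]; simp add: gf_II_def quad_simps)
  apply (rule alg_II_I[of _ q0 "quad 0 0 0 0 0 1" q0 q0]; simp add: gf_II_def quad_simps)
  apply (rule alg_II_I[of _ "quad 0 0 0 (1/2) 0 0" q0 q0 q0]; simp add: gf_II_def quad_simps)
  apply (rule alg_II_I[of _ "quad 0 0 0 0 1 0" q0 q0 q0]; simp add: gf_II_def quad_simps)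
  apply (rule alg_II_I[of _ "quad 0 0 0 0 0 (1/2)" q0 q0 q0]; simp add: gf_II_def quad_simps)
  apply (rule alg_II_I[of _ q0 q0 "quad 0 0 0 1 0 0" q0]; simp add: gf_II_def quad_simps)
  apply (rule alg_II_I[of _ q0 q0 "quad 0 0 0 0 1 0" q0]; simp add: gf_II_def quad_simps)
  apply (rule alg_II_I[of _ q0 q0 q0 "quad 0 0 0 1 0 0"]; simp add: gf_II_def quad_simps)
  apply (rule alg_II_I[of _ q0 q0 q0 "quad 0 0 0 0 1 0"]; simp add: gf_II_def quad_simps)
  done

definition dI_II :: "J2 \<Rightarrow> (4 \<Rightarrow> 4 \<Rightarrow> real) \<Rightarrow> real" where
  "dI_II w \<eta> = uu 2 4 w * uu 1 4 w * \<eta> 1 3 + uu 1 3 w * uu 1 4 w * \<eta> 2 4 - uu 3 4 w * uu 1 4 w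
      * \<eta> 1 2
    - uu 1 2 w * uu 1 4 w * \<eta> 3 4 - (uu 1 3 w * uu 2 4 w - uu 1 2 w * uu 3 4 w) * \<eta> 1 4"

text \<open>A_0 fixes u_14 and acts on the 2 by 2 matrix with rows 1, 4 and columns 2, 3 by
  trace-free matrices, so its determinant, up to sign the numerator of \<open>I_II\<close>, is
  stationary. C_0 scales u_14, u_24, u_34 alike and changes u_12, u_13 by a common multiple of u_14
  u_24, u_14 u_34, which cancels in the numerator; B_0 does the same with 1 and 4 exchanged.\<close>

lemma hessian_II:
  assumes "f \<in> alg_II"
  shows "\<exists>B. has_hessian f B \<and> dI_II w (\<lambda>i k. hess_vec w B $ Upair i k) = 0"
proof (rule hessianI)
  obtain A\<^sub>0 A\<^sub>1 B\<^sub>0 C\<^sub>0 where s: "smooth_on UNIV A\<^sub>0" "smooth_on UNIV A\<^sub>1" "smooth_on UNIV B\<^sub>0"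
      "smooth_on UNIV C\<^sub>0"
    and f: "f = gf_II A\<^sub>0 A\<^sub>1 B\<^sub>0 C\<^sub>0"
    using assms unfolding alg_II_iff by blast
  note s1 = s[THEN smooth_on_D(1)] s[THEN smooth_on_D(2)]
  show "\<exists>f' B. jet2 f f' B \<and> u_free f' \<and> dI_II w (\<lambda>i k. B (fst w) (tvec w i) (tvec w k)) = 0"
    unfolding f gf_II_def
    apply (intro exI conjI)
    apply (rule jet2_add jet2_diff jet2_mult jet2_const jet2_coord
        s[THEN jet2_plane_coord] s1[THEN jet2_plane_coord])+
    apply (simp add: u_free_def)
    apply (simp add: dI_II_def s[THEN D1_D2_commute])
    apply (simp add: field_simps power2_eq_square)?
    done
qed

text \<open>Besides the denominator u_14, two factors must be non-zero: u_24 is the numerator of the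
  pivot coefficient of u_13, and u_13 is divided out when solving for a_12.\<close>

lemma only_diff_invariant2_II: "only_diff_invariant2 alg_II {w. uu 1 4 w \<noteq> 0} I_II"
proof (rule only_diff_invariant2I[OF heisenberg_II, where
      E="{w. uu 1 4 w \<noteq> 0} \<inter> ({w. uu 2 4 w \<noteq> 0} \<inter> {w. uu 1 3 w \<noteq> 0})"
      and e="(0, axis (Upair 1 3) 1)" and c="\<lambda>w. uu 2 4 w / uu 1 4 w"
      and j="\<lambda>w h. dI_II w (\<lambda>i k. h $ Upair i k) / (uu 1 4 w)^2"])
  show "open {w. uu 1 4 w \<noteq> 0}"
    by (rule open_uu open_UNIV)
  show "smooth_on {w. uu 1 4 w \<noteq> 0} I_II"
    unfolding I_II_def[abs_def]
    by (intro smooth_on_diff smooth_on_add smooth_on_mult smooth_on_power smooth_on_divide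
        smooth_on_uu)
      (auto intro: open_uu)
  show "(I_II has_derivative (\<lambda>v. dI_II w (\<lambda>i k. snd v $ Upair i k) / (uu 1 4 w)^2)) (at w)" if "w
      \<in> {w. uu 1 4 w \<noteq> 0}" for w
    unfolding I_II_def[abs_def] dI_II_def
    by (rule has_derivative_eq_rhs, (rule derivative_intros has_derivative_uu)+)
      (use that in \<open>auto simp: fun_eq_iff field_simps power2_eq_square\<close>)
  show "\<exists>B. has_hessian f B \<and> dI_II w (\<lambda>i k. hess_vec w B $ Upair i k) / (uu 1 4 w)^2 = 0"
    if f: "f \<in> alg_II" for f w
  proof -
    obtain B where "has_hessian f B" "dI_II w (\<lambda>i k. hess_vec w B $ Upair i k) = 0"
      using hessian_II[OF f, of w] by blast
    then show ?thesis by (intro exI[of _ B]) simp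
  qed
  show "open ({w. uu 1 4 w \<noteq> 0} \<inter> ({w. uu 2 4 w \<noteq> 0} \<inter> {w. uu 1 3 w \<noteq> 0}))" "closure ({w. uu 1 4 w
      \<noteq> 0} \<inter> ({w. uu 2 4 w \<noteq> 0} \<inter> {w. uu 1 3 w \<noteq> 0})) = UNIV"
    by (intro open_Int dense_Int open_uu dense_uu open_UNIV closure_UNIV)+
  show "smooth_on ({w. uu 1 4 w \<noteq> 0} \<inter> ({w. uu 2 4 w \<noteq> 0} \<inter> {w. uu 1 3 w \<noteq> 0})) (\<lambda>w. uu 2 4 w / uu
      1 4 w)"
    by (intro smooth_on_divide smooth_on_diff smooth_on_mult smooth_on_uminus smooth_on_uu
        smooth_on_const open_Int
        open_uu open_UNIV) auto
  show "I_II (w + h *\<^sub>R (0, axis (Upair 1 3) 1)) = I_II w + h * (uu 2 4 w / uu 1 4 w)" for w h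
    unfolding I_II_def uu_axis by (simp add: add_divide_distrib diff_divide_distrib algebra_simps)
next
  fix w and h :: "real^(4 uprod)" and L :: "real^(4 uprod) \<Rightarrow> real"
  assume w: "w \<in> {w. uu 1 4 w \<noteq> 0} \<inter> ({w. uu 2 4 w \<noteq> 0} \<inter> {w. uu 1 3 w \<noteq> 0})"
    and L: "L \<in> annihilator alg_II w"
    and h: "dI_II w (\<lambda>i k. h $ Upair i k) / (uu 1 4 w)^2 = 0"
  define a where "a i j = L (axis (Upair i j) 1)" for i j
  note R = quadrics_II[THEN quadric_relation, OF L refl a_def, simplified]
  have zero: "a 1 1 = 0" "a 2 2 = 0" "a 2 3 = 0" "a 3 3 = 0" "a 4 4 = 0"
    using R by simp_all
  note R = R[unfolded zero, simplified]
  from zero have "L h = a 1 2 * h $ Upair 1 2 + a 1 3 * h $ Upair 1 3 + a 1 4 * h $ Upair 1 4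
      + a 2 4 * h $ Upair 2 4 + a 3 4 * h $ Upair 3 4"
    using L by (simp add: annihilator_def linear_uprod_expansion[of L h] sum_uprod_4 a_def)
  moreover define l where "l = a 1 3 / (uu 2 4 w * uu 1 4 w)"
  have nz: "uu 1 4 w \<noteq> 0" "uu 2 4 w \<noteq> 0" "uu 1 3 w \<noteq> 0" using w by auto
  have a13: "a 1 3 = l * (uu 2 4 w * uu 1 4 w)" using nz by (simp add: l_def)
  \<comment> \<open>With b_ij = a_ij u_ij, the equations of x u_x and t u_t give b_12 + b_13 = b_24
    + b_34, and that of y u_y - z u_z gives b_12 + b_24 = b_13 + b_34. Their difference is twice the
    claim.\<close>
  have "a 2 4 * uu 2 4 w = a 1 3 * uu 1 3 w" using R(5,8,10) by linarith
  then have "a 2 4 * uu 2 4 w = (l * (uu 1 3 w * uu 1 4 w))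
      * uu 2 4 w" by (simp only: a13 ac_simps)
  then have a24: "a 2 4 = l * (uu 1 3 w * uu 1 4 w)" by (simp only: mult_right_cancel nz
      not_False_eq_True)
  have "a 3 4 * uu 2 4 w = (- l * (uu 1 2 w * uu 1 4 w)) * uu 2 4 w"
    using R(6) a13 by (simp add: algebra_simps)
  then have a34: "a 3 4 = - l * (uu 1 2 w * uu 1 4 w)" by (simp only: mult_right_cancel nz
      not_False_eq_True)
  have "a 1 2 * uu 1 3 w = (- l * (uu 3 4 w * uu 1 4 w)) * uu 1 3 w"
    using R(4) a24 by (simp add: algebra_simps)
  then have a12: "a 1 2 = - l * (uu 3 4 w * uu 1 4 w)" by (simp only: mult_right_cancel nz
      not_False_eq_True)
  have "a 1 4 * uu 1 4 w = (- l * (uu 1 3 w * uu 2 4 w - uu 1 2 w * uu 3 4 w)) * uu 1 4 w"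
    using R(8) unfolding a12 a13 by (simp add: algebra_simps)
  then have "a 1 4 = - l * (uu 1 3 w * uu 2 4 w - uu 1 2 w
      * uu 3 4 w)" by (simp only: mult_right_cancel nz not_False_eq_True)
  note this a12 a13 a24 a34
  ultimately have "L h = l * dI_II w (\<lambda>i k. h $ Upair i k)"
    by (simp only: dI_II_def) (simp add: algebra_simps power2_eq_square)
  then show "L h = 0" using h w by simp
qed auto

subsection \<open>Case I\<close>

lemma open_I: "open {w. uu 1 2 w * uu 3 4 w - uu 1 4 w * uu 2 3 w \<noteq> 0}"
  by (rule open_Collect_neq)
    (auto intro!: smooth_on_continuous_on smooth_on_diff smooth_on_mult smooth_on_uu)

lemma dense_I: "closure {w. uu 1 2 w * uu 3 4 w - uu 1 4 w * uu 2 3 w \<noteq> 0} = UNIV"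
  by (rule dense_nonzero[where e="(0, axis (Upair 1 2) 1)" and c="\<lambda>w. uu 3 4 w"])
    (simp_all only: uu_axis dense_uu, simp add: algebra_simps)

definition gf_I :: "(real \<times> real \<Rightarrow> real) \<Rightarrow> (real \<times> real \<Rightarrow> real) \<Rightarrow> (real \<times> real \<Rightarrow> real)
    \<Rightarrow> (real \<times> real \<Rightarrow> real) \<Rightarrow> J1 \<Rightarrow> real" where
  "gf_I A\<^sub>1 A\<^sub>2 A\<^sub>3 A\<^sub>4 = (\<lambda>q. A\<^sub>1 (coord (X 1) q, coord (P 1) q)
      + A\<^sub>2 (coord (X 2) q, coord (P 2) q) + A\<^sub>3 (coord (X 3) q, coord (P 3) q)
      + A\<^sub>4 (coord (X 4) q, coord (P 4) q))"

lemma alg_I_iff: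
  "f \<in> alg_I \<longleftrightarrow> (\<exists>A\<^sub>1 A\<^sub>2 A\<^sub>3 A\<^sub>4. smooth_on UNIV A\<^sub>1 \<and> smooth_on UNIV A\<^sub>2 \<and> smooth_on UNIV A\<^sub>3
      \<and> smooth_on UNIV A\<^sub>4 \<and>
    f = gf_I A\<^sub>1 A\<^sub>2 A\<^sub>3 A\<^sub>4)"
  unfolding alg_I_def mem_Collect_eq fun_eq_iff gf_I_def
  by (simp add: Let_def coord.simps power2_eq_square mult.assoc) blast

lemma alg_I_I:
  assumes "\<And>q. f q = gf_I A\<^sub>1 A\<^sub>2 A\<^sub>3 A\<^sub>4 q"
    and "smooth_on UNIV A\<^sub>1" "smooth_on UNIV A\<^sub>2" "smooth_on UNIV A\<^sub>3" "smooth_on UNIV A\<^sub>4"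
  shows "f \<in> alg_I"
  unfolding alg_I_iff using assms by blast

lemma heisenberg_I: "heisenberg \<subseteq> alg_I"
  apply (rule heisenbergI)
  apply (rule alg_I_I[of _ "quad 1 0 0 0 0 0" q0 q0 q0]; simp add: gf_I_def quad_simps)
  apply (rule alg_I_I[of _ "quad 0 1 0 0 0 0" q0 q0 q0]; simp add: gf_I_def quad_simps)
  apply (rule alg_I_I[of _ q0 "quad 0 1 0 0 0 0" q0 q0]; simp add: gf_I_def quad_simps)
  apply (rule alg_I_I[of _ q0 q0 "quad 0 1 0 0 0 0" q0]; simp add: gf_I_def quad_simps)
  apply (rule alg_I_I[of _ q0 q0 q0 "quad 0 1 0 0 0 0"]; simp add: gf_I_def quad_simps)
  apply (rule alg_I_I[of _ "quad 0 0 1 0 0 0" q0 q0 q0]; simp add: gf_I_def quad_simps)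
  apply (rule alg_I_I[of _ q0 "quad 0 0 1 0 0 0" q0 q0]; simp add: gf_I_def quad_simps)
  apply (rule alg_I_I[of _ q0 q0 "quad 0 0 1 0 0 0" q0]; simp add: gf_I_def quad_simps)
  apply (rule alg_I_I[of _ q0 q0 q0 "quad 0 0 1 0 0 0"]; simp add: gf_I_def quad_simps)
  done

text \<open>The squares x_i^2 remove the a_ii. The four scalings x_i u_i still leave two free
  parameters among the six remaining coefficients, and u_1^2 supplies the missing equation.\<close>

lemma quadrics_I:
  "quadric [(1, X 1, X 1)] \<in> alg_I"
  "quadric [(1, X 2, X 2)] \<in> alg_I"
  "quadric [(1, X 3, X 3)] \<in> alg_I"
  "quadric [(1, X 4, X 4)] \<in> alg_I"
  "quadric [(1, X 1, P 1)] \<in> alg_I"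
  "quadric [(1, X 2, P 2)] \<in> alg_I"
  "quadric [(1, X 3, P 3)] \<in> alg_I"
  "quadric [(1, X 4, P 4)] \<in> alg_I"
  "quadric [(1, P 1, P 1)] \<in> alg_I"
  apply (rule alg_I_I[of _ "quad 0 0 0 1 0 0" q0 q0 q0]; simp add: gf_I_def quad_simps)
  apply (rule alg_I_I[of _ q0 "quad 0 0 0 1 0 0" q0 q0]; simp add: gf_I_def quad_simps)
  apply (rule alg_I_I[of _ q0 q0 "quad 0 0 0 1 0 0" q0]; simp add: gf_I_def quad_simps)
  apply (rule alg_I_I[of _ q0 q0 q0 "quad 0 0 0 1 0 0"]; simp add: gf_I_def quad_simps)
  apply (rule alg_I_I[of _ "quad 0 0 0 0 1 0" q0 q0 q0]; simp add: gf_I_def quad_simps)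
  apply (rule alg_I_I[of _ q0 "quad 0 0 0 0 1 0" q0 q0]; simp add: gf_I_def quad_simps)
  apply (rule alg_I_I[of _ q0 q0 "quad 0 0 0 0 1 0" q0]; simp add: gf_I_def quad_simps)
  apply (rule alg_I_I[of _ q0 q0 q0 "quad 0 0 0 0 1 0"]; simp add: gf_I_def quad_simps)
  apply (rule alg_I_I[of _ "quad 0 0 0 0 0 1" q0 q0 q0]; simp add: gf_I_def quad_simps)
  done

text \<open>With p = u_12 u_34, q = u_13 u_24, r = u_14 u_23 this is (q - r) dp - (p - r) dq + (p -
  q) dr, which is (p - r)^2 times the differential of (p - q)/(p - r).\<close>

definition dI_I :: "J2 \<Rightarrow> (4 \<Rightarrow> 4 \<Rightarrow> real) \<Rightarrow> real" where
  "dI_I w \<eta> = (uu 1 3 w * uu 2 4 w - uu 1 4 w * uu 2 3 w) * (uu 3 4 w * \<eta> 1 2 + uu 1 2 w * \<eta> 3 4)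
    - (uu 1 2 w * uu 3 4 w - uu 1 4 w * uu 2 3 w) * (uu 2 4 w * \<eta> 1 3 + uu 1 3 w * \<eta> 2 4)
    + (uu 1 2 w * uu 3 4 w - uu 1 3 w * uu 2 4 w) * (uu 2 3 w * \<eta> 1 4 + uu 1 4 w * \<eta> 2 3)"

text \<open>The products u_12 u_34, u_13 u_24, u_14 u_23 have degree one in each index, so the
  scaling part of each A_i multiplies them alike. The second derivative of A_4 in u_4 adds the same
  multiple of u_14 u_24 u_34 to all three, and similarly for the other A_i. Ratios of their
  differences are thus stationary.\<close>

lemma hessian_I:
  assumes "f \<in> alg_I"
  shows "\<exists>B. has_hessian f B \<and> dI_I w (\<lambda>i k. hess_vec w B $ Upair i k) = 0"
proof (rule hessianI)
  obtain A\<^sub>1 A\<^sub>2 A\<^sub>3 A\<^sub>4 where s: "smooth_on UNIV A\<^sub>1" "smooth_on UNIV A\<^sub>2" "smooth_on UNIV A\<^sub>3"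
      "smooth_on UNIV A\<^sub>4"
    and f: "f = gf_I A\<^sub>1 A\<^sub>2 A\<^sub>3 A\<^sub>4"
    using assms unfolding alg_I_iff by blast
  show "\<exists>f' B. jet2 f f' B \<and> u_free f' \<and> dI_I w (\<lambda>i k. B (fst w) (tvec w i) (tvec w k)) = 0"
    unfolding f gf_I_def
    apply (intro exI conjI)
    apply (rule jet2_add jet2_diff jet2_mult jet2_const jet2_coord
        s[THEN jet2_plane_coord])+
    apply (simp add: u_free_def)
    apply (simp add: dI_I_def)
    apply (simp add: field_simps power2_eq_square)?
    done
qed

lemma only_diff_invariant2_I: "only_diff_invariant2 alg_I {w. uu 1 2 w * uu 3 4 w - uu 1 4 w
    * uu 2 3 w \<noteq> 0} I_I"
proof (rule only_diff_invariant2I[OF heisenberg_I, where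
      E="{w. uu 1 2 w * uu 3 4 w - uu 1 4 w * uu 2 3 w \<noteq> 0} \<inter> ({w. uu 1 2 w \<noteq> 0} \<inter> ({w. uu 1 3 w \<noteq>
          0} \<inter>
        ({w. uu 1 4 w \<noteq> 0} \<inter> ({w. uu 2 3 w \<noteq> 0} \<inter> ({w. uu 2 4 w \<noteq> 0} \<inter> {w. uu 3 4 w \<noteq> 0})))))"
      and e="(0, axis (Upair 1 3) 1)" and c="\<lambda>w. - uu 2 4 w / (uu 1 2 w * uu 3 4 w - uu 1 4 w
          * uu 2 3 w)"
      and j="\<lambda>w h. dI_I w (\<lambda>i k. h $ Upair i k) / ((uu 1 2 w * uu 3 4 w - uu 1 4 w
          * uu 2 3 w))^2"])
  show "open {w. uu 1 2 w * uu 3 4 w - uu 1 4 w * uu 2 3 w \<noteq> 0}"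
    by (rule open_I)
  show "smooth_on {w. uu 1 2 w * uu 3 4 w - uu 1 4 w * uu 2 3 w \<noteq> 0} I_I"
    unfolding I_I_def[abs_def]
    by (intro smooth_on_diff smooth_on_add smooth_on_mult smooth_on_power smooth_on_divide
        smooth_on_uu)
      (auto intro: open_uu open_I[simplified])
  show "(I_I has_derivative (\<lambda>v. dI_I w (\<lambda>i k. snd v $ Upair i k) / ((uu 1 2 w * uu 3 4 w
      - uu 1 4 w * uu 2 3 w))^2)) (at w)" if "w \<in> {w. uu 1 2 w * uu 3 4 w - uu 1 4 w
      * uu 2 3 w \<noteq> 0}" for w
    unfolding I_I_def[abs_def] dI_I_def
    by (rule has_derivative_eq_rhs, (rule derivative_intros has_derivative_uu)+)
      (use that in \<open>auto simp: fun_eq_iff field_simps power2_eq_square\<close>)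
  show "\<exists>B. has_hessian f B \<and> dI_I w (\<lambda>i k. hess_vec w B $ Upair i k) / ((uu 1 2 w * uu 3 4 w
      - uu 1 4 w * uu 2 3 w))^2 = 0"
    if f: "f \<in> alg_I" for f w
  proof -
    obtain B where "has_hessian f B" "dI_I w (\<lambda>i k. hess_vec w B $ Upair i k) = 0"
      using hessian_I[OF f, of w] by blast
    then show ?thesis by (intro exI[of _ B]) simp
  qed
  show "open ({w. uu 1 2 w * uu 3 4 w - uu 1 4 w * uu 2 3 w \<noteq> 0} \<inter> ({w. uu 1 2 w \<noteq> 0} \<inter> ({w. uu 1
      3 w \<noteq> 0} \<inter>
        ({w. uu 1 4 w \<noteq> 0} \<inter> ({w. uu 2 3 w \<noteq> 0} \<inter> ({w. uu 2 4 w \<noteq> 0} \<inter> {w. uu 3 4 w \<noteq> 0}))))))"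
            "closure ({w. uu 1 2 w * uu 3 4 w - uu 1 4 w * uu 2 3 w \<noteq> 0} \<inter> ({w. uu 1 2 w \<noteq> 0} \<inter>
            ({w. uu 1 3 w \<noteq> 0} \<inter>
        ({w. uu 1 4 w \<noteq> 0} \<inter> ({w. uu 2 3 w \<noteq> 0} \<inter> ({w. uu 2 4 w \<noteq> 0} \<inter> {w. uu 3 4 w \<noteq> 0}))))))
            = UNIV"
    by (intro open_Int dense_Int open_uu dense_uu open_I dense_I open_UNIV closure_UNIV)+
  show "smooth_on ({w. uu 1 2 w * uu 3 4 w - uu 1 4 w
      * uu 2 3 w \<noteq> 0} \<inter> ({w. uu 1 2 w \<noteq> 0} \<inter> ({w. uu 1 3 w \<noteq> 0} \<inter>
        ({w. uu 1 4 w \<noteq> 0} \<inter> ({w. uu 2 3 w \<noteq> 0} \<inter> ({w. uu 2 4 w \<noteq> 0} \<inter> {w. uu 3 4 w \<noteq> 0}))))))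
            (\<lambda>w. - uu 2 4 w / (uu 1 2 w * uu 3 4 w - uu 1 4 w * uu 2 3 w))"
    by (intro smooth_on_divide smooth_on_diff smooth_on_mult smooth_on_uminus smooth_on_uu
        smooth_on_const open_Int
        open_uu open_I open_UNIV) auto
  show "I_I (w + h *\<^sub>R (0, axis (Upair 1 3) 1)) = I_I w + h * (- uu 2 4 w / (uu 1 2 w * uu 3 4 w
      - uu 1 4 w * uu 2 3 w))" for w h
    unfolding I_I_def uu_axis by (simp add: add_divide_distrib diff_divide_distrib algebra_simps)
next
  fix w and h :: "real^(4 uprod)" and L :: "real^(4 uprod) \<Rightarrow> real"
  assume w: "w \<in> {w. uu 1 2 w * uu 3 4 w - uu 1 4 w * uu 2 3 w \<noteq> 0} \<inter> ({w. uu 1 2 w \<noteq> 0} \<inter> ({w. uu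
      1 3 w \<noteq> 0} \<inter>
        ({w. uu 1 4 w \<noteq> 0} \<inter> ({w. uu 2 3 w \<noteq> 0} \<inter> ({w. uu 2 4 w \<noteq> 0} \<inter> {w. uu 3 4 w \<noteq> 0})))))"
    and L: "L \<in> annihilator alg_I w"
    and h: "dI_I w (\<lambda>i k. h $ Upair i k) / ((uu 1 2 w * uu 3 4 w - uu 1 4 w * uu 2 3 w))^2 = 0"
  define a where "a i j = L (axis (Upair i j) 1)" for i j
  note R = quadrics_I[THEN quadric_relation, OF L refl a_def, simplified]
  have zero: "a 1 1 = 0" "a 2 2 = 0" "a 3 3 = 0" "a 4 4 = 0"
    using R by simp_all
  note R = R[unfolded zero, simplified]
  from zero have "L h = a 1 2 * h $ Upair 1 2 + a 1 3 * h $ Upair 1 3 + a 1 4 * h $ Upair 1 4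
      + a 2 3 * h $ Upair 2 3 + a 2 4 * h $ Upair 2 4 + a 3 4 * h $ Upair 3 4"
    using L by (simp add: annihilator_def linear_uprod_expansion[of L h] sum_uprod_4 a_def)
  \<comment> \<open>The sign comes from the coefficient -u_24 (p - r) of \<eta>_13 in
    \<open>dI_I\<close>.\<close>
  moreover define l where "l = - a 1 3 / (uu 2 4 w * (uu 1 2 w * uu 3 4 w - uu 1 4 w * uu 2 3 w))"
  define p q r where "p = uu 1 2 w * uu 3 4 w" and "q = uu 1 3 w * uu 2 4 w" and "r = uu 1 4 w
      * uu 2 3 w"
  note pqr = p_def q_def r_def
  have nz: "uu 1 2 w \<noteq> 0" "uu 1 3 w \<noteq> 0" "uu 1 4 w \<noteq> 0" "uu 2 3 w \<noteq> 0" "uu 2 4 w \<noteq> 0"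
    "uu 3 4 w \<noteq> 0" "p - r \<noteq> 0"
    using w by (auto simp: pqr)
  then have "uu 1 2 w * q * (p - r) \<noteq> 0" by (simp add: q_def)
  note nz = nz this
  have l: "l = - a 1 3 / (uu 2 4 w * (p - r))" by (simp add: l_def pqr)
  have a13: "a 1 3 = - l * (uu 2 4 w * (p - r))" unfolding l using nz by simp
  \<comment> \<open>Put b_ij = a_ij u_ij on the edges of the complete graph on 1, 2, 3, 4. The
    scalings say that the b_ij at each vertex add up to 0; hence opposite edges carry equal values,
    and the three values have sum 0.\<close>
  have X: "a 3 4 * uu 3 4 w = a 1 2 * uu 1 2 w" "a 2 4 * uu 2 4 w = a 1 3 * uu 1 3 w"
    "a 2 3 * uu 2 3 w = a 1 4 * uu 1 4 w" "a 1 4 * uu 1 4 w = - a 1 2 * uu 1 2 w - a 1 3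
        * uu 1 3 w"
    using R(5-8) by linarith+
  have "a 2 4 * uu 2 4 w = (- l * (uu 1 3 w * (p - r))) * uu 2 4 w"
    unfolding X(2) a13 by (simp add: algebra_simps)
  then have a24: "a 2 4 = - l * (uu 1 3 w * (p - r))" by (simp only: mult_right_cancel nz
      not_False_eq_True)
  \<comment> \<open>The terms of the u_1^2 equation that contain u_11 add up to zero by the scaling
    equation of x_1 u_1.\<close>
  have "uu 1 1 w * (a 1 2 * uu 1 2 w + (a 1 3 * uu 1 3 w + a 1 4 * uu 1 4 w)) = 0"
    using X(4) by simp
  then have "uu 1 2 w * uu 1 3 w * a 2 3 + uu 1 2 w * uu 1 4 w * a 2 4 + uu 1 3 w * uu 1 4 w
      * a 3 4 = 0"
    using R(9) by (simp add: algebra_simps)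
  \<comment> \<open>The extra factor turns the coefficients into products of p, q, r. If \<alpha>,
    \<beta>, \<gamma> are the values of b on the edge pairs of p, q, r, the result is \<alpha>/p +
    \<beta>/q + \<gamma>/r = 0 cleared of denominators; together with \<alpha> + \<beta> + \<gamma>
    = 0 it fixes the ratio of \<alpha> to \<beta>.\<close>
  then have "(uu 1 2 w * uu 1 3 w * a 2 3 + uu 1 2 w * uu 1 4 w * a 2 4 + uu 1 3 w * uu 1 4 w
      * a 3 4)
      * (uu 2 3 w * uu 2 4 w * uu 3 4 w) = 0" by simp
  then have "p * q * (a 2 3 * uu 2 3 w) + p * r * (a 2 4 * uu 2 4 w) + q * r * (a 3 4 * uu 3 4 w)
      = 0"
    by (simp add: pqr algebra_simps)
  then have "a 1 2 * uu 1 2 w * q * (p - r) = - (a 1 3 * uu 1 3 w) * p * (q - r)"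
    unfolding X by (simp add: algebra_simps)
  then have "a 1 2 * (uu 1 2 w * q * (p - r)) = (l * (uu 3 4 w * (q - r))) * (uu 1 2 w * q * (p
      - r))"
    unfolding a13 by (simp add: p_def q_def algebra_simps)
  then have a12: "a 1 2 = l * (uu 3 4 w * (q - r))" by (simp only: mult_right_cancel nz
      not_False_eq_True)
  have "a 3 4 * uu 3 4 w = (l * (uu 1 2 w * (q - r))) * uu 3 4 w"
    unfolding X(1) a12 by (simp add: algebra_simps)
  then have a34: "a 3 4 = l * (uu 1 2 w * (q - r))" by (simp only: mult_right_cancel nz
      not_False_eq_True)
  have "a 1 4 * uu 1 4 w = (l * (uu 2 3 w * (p - q))) * uu 1 4 w"
    unfolding X(4) a12 a13 by (simp add: pqr algebra_simps)
  then have a14: "a 1 4 = l * (uu 2 3 w * (p - q))" by (simp only: mult_right_cancel nz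
      not_False_eq_True)
  have "a 2 3 * uu 2 3 w = (l * (uu 1 4 w * (p - q))) * uu 2 3 w"
    unfolding X(3) a14 by (simp add: algebra_simps)
  then have "a 2 3 = l * (uu 1 4 w * (p - q))" by (simp only: mult_right_cancel nz
      not_False_eq_True)
  note a12 a13 a14 this a24 a34
  ultimately have "L h = l * dI_I w (\<lambda>i k. h $ Upair i k)"
    by (simp only: dI_I_def) (simp add: p_def q_def r_def algebra_simps power2_eq_square)
  then show "L h = 0" using h w by simp
qed auto

theorem theorem2:
  shows
    "(\<forall>i. diff_invariant1 alg_O UNIV (\<lambda>(x, u, p). x $ i)) \<and>
     (\<forall>U I. diff_invariant1 alg_O U I \<longrightarrow>
        locally_function_of U I (\<lambda>(x, u, p). x)) \<and>
     (\<forall>i. diff_invariant2 alg_O UNIV (\<lambda>((x, u, p), H). x $ i)) \<and>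
     diff_invariant2 alg_O UNIV I_O \<and>
     (\<forall>U I. diff_invariant2 alg_O U I \<longrightarrow>
        generically_function_of U I UNIV (\<lambda>w. (fst (fst w), I_O w))) \<and>
     no_diff_invariants1 alg_N \<and> only_diff_invariant2 alg_N UNIV I_N \<and>
     no_diff_invariants1 alg_D \<and> only_diff_invariant2 alg_D UNIV I_D \<and>
     no_diff_invariants1 alg_III \<and>
     only_diff_invariant2 alg_III {w. uu 3 4 w \<noteq> 0} I_III \<and>
     no_diff_invariants1 alg_II \<and>
     only_diff_invariant2 alg_II {w. uu 1 4 w \<noteq> 0} I_II \<and>
     no_diff_invariants1 alg_I \<and>
     only_diff_invariant2 alg_I
       {w. uu 1 2 w * uu 3 4 w - uu 1 4 w * uu 2 3 w \<noteq> 0} I_I"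
  by (intro conjI allI impI diff_invariant1_O_x diff_invariant1_O_function_of_x diff_invariant2_O_x
      diff_invariant2_I_O diff_invariant2_O_function_of_I_O
      no_diff_invariants1I[OF heisenberg_N] only_diff_invariant2_N
      no_diff_invariants1I[OF heisenberg_D] only_diff_invariant2_D
      no_diff_invariants1I[OF heisenberg_III] only_diff_invariant2_III
      no_diff_invariants1I[OF heisenberg_II] only_diff_invariant2_II
      no_diff_invariants1I[OF heisenberg_I] only_diff_invariant2_I)

end
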